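(* Let $G$ be a virtually free group with a free subgroup of finite index $d$, and let $g\in G$. Then $\operatorname{scl}(g)=0$ if and only if there exists a nonzero integer $n$ such that $g^n$ is conjugate to $g^{-n}$ in $G$. Otherwise, $\operatorname{scl}(g)\ge \frac{1}{8d}$.
   Context: A group is virtually free if it contains a free subgroup of finite index (free groups may have infinite rank). Let $G$ be a group. A function $\Phi: G\to\mathbf{R}$ is a quasimorphism if there is $D\ge 0$ with $|\Phi(gh)-\Phi(g)-\Phi(h)|\le D$ for all $g,h\in G$; the infimum of such $D$ is the defect $D_\Phi$. A quasimorphism is homogeneous if it restricts to a homomorphism on every cyclic subgroup, i.e. $\Phi(g^n)=n\Phi(g)$ for all $g\in G$, $n\in\mathbf{Z}$. $C_n(G)$ is the real vector space freely generated by $n$-tuples of elements of $G$, and $B_1(G)\subset C_1(G)$ is the image of the linear (inhomogeneous bar complex) boundary map $\partial:C_2(G)\to C_1(G)$, $\partial(g,h)=g-gh+h$. For $g\in G$ with $g\in B_1(G)$ (equivalently, some positive power of $g$ lies in $[G,G]$), the stable commutator length is defined (via Bavard duality) by $$\operatorname{scl}(g)=\sup_\phi\frac{\phi(g)}{2D_\phi},$$ where $\phi$ ranges over all homogeneous quasimorphisms on $G$. Those with $D_\phi=0$ are homomorphisms, which vanish at such $g$, and are ignored in the supremum; the supremum is taken to be $0$ if there is no homogeneous quasimorphism with $D_\phi>0$. For $g\notin B_1(G)$, $\operatorname{scl}(g)=\infty$ by convention. *)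

theory Defs
  imports "HOL-Algebra.Algebra" "HOL-Library.Extended_Real"
begin

section \<open>Free groups\<close>

text \<open>
  A letter \<open>(x, True)\<close> stands for \<open>x\<close> and \<open>(x, False)\<close> for its formal inverse. A word is
  reduced if no letter is followed by its formal inverse.
\<close>

definition reduced_word :: "('a \<times> bool) list \<Rightarrow> bool" where
  "reduced_word w \<longleftrightarrow> successively (\<lambda>a b. fst a = fst b \<longrightarrow> snd a = snd b) w"

definition word_value :: "('a, 'b) monoid_scheme \<Rightarrow> ('a \<times> bool) list \<Rightarrow> 'a" where
  "word_value G w =
     foldr (\<lambda>(x, e) y. (if e then x else inv\<^bsub>G\<^esub> x) \<otimes>\<^bsub>G\<^esub> y) w \<one>\<^bsub>G\<^esub>"

text \<open>
  \<open>S\<close> is a free basis of \<open>G\<close> if each element of \<open>G\<close> is the value of exactly one reduced word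
  in \<open>S\<close> and its formal inverses. Bases may be infinite or empty.
\<close>

definition free_basis :: "('a, 'b) monoid_scheme \<Rightarrow> 'a set \<Rightarrow> bool" where
  "free_basis G S \<longleftrightarrow>
     S \<subseteq> carrier G \<and>
     bij_betw (word_value G) {w \<in> lists (S \<times> UNIV). reduced_word w} (carrier G)"

definition free_group :: "('a, 'b) monoid_scheme \<Rightarrow> bool" where
  "free_group G \<longleftrightarrow> group G \<and> (\<exists>S. free_basis G S)"

section \<open>Homogeneous quasimorphisms\<close>

definition defect_bound :: "('a, 'b) monoid_scheme \<Rightarrow> ('a \<Rightarrow> real) \<Rightarrow> real \<Rightarrow> bool" where
  "defect_bound G \<phi> D \<longleftrightarrow>
     D \<ge> 0 \<and> (\<forall>g\<in>carrier G. \<forall>h\<in>carrier G. \<bar>\<phi> (g \<otimes>\<^bsub>G\<^esub> h) - \<phi> g - \<phi> h\<bar> \<le> D)"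

definition quasimorphism :: "('a, 'b) monoid_scheme \<Rightarrow> ('a \<Rightarrow> real) \<Rightarrow> bool" where
  "quasimorphism G \<phi> \<longleftrightarrow> (\<exists>D. defect_bound G \<phi> D)"

definition defect :: "('a, 'b) monoid_scheme \<Rightarrow> ('a \<Rightarrow> real) \<Rightarrow> real" where
  "defect G \<phi> = Inf {D. defect_bound G \<phi> D}"

definition homogeneous_quasimorphism :: "('a, 'b) monoid_scheme \<Rightarrow> ('a \<Rightarrow> real) \<Rightarrow> bool" where
  "homogeneous_quasimorphism G \<phi> \<longleftrightarrow>
     quasimorphism G \<phi> \<and>
     (\<forall>g\<in>carrier G. \<forall>n::int. \<phi> (g [^]\<^bsub>G\<^esub> n) = of_int n * \<phi> g)"

section \<open>Inhomogeneous bar chains\<close>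

text \<open>
  The real vector space freely generated by a set is modelled as the finitely supported
  real functions vanishing outside that set; 1-tuples are identified with elements.
\<close>

definition free_real_space :: "'x set \<Rightarrow> ('x \<Rightarrow> real) set" where
  "free_real_space S = {c. finite {x. c x \<noteq> 0} \<and> {x. c x \<noteq> 0} \<subseteq> S}"

definition basis_vector :: "'x \<Rightarrow> 'x \<Rightarrow> real" where
  "basis_vector x = (\<lambda>y. if y = x then 1 else 0)"

definition bar_C1 :: "('a, 'b) monoid_scheme \<Rightarrow> ('a \<Rightarrow> real) set" where
  "bar_C1 G = free_real_space (carrier G)"

definition bar_C2 :: "('a, 'b) monoid_scheme \<Rightarrow> ('a \<times> 'a \<Rightarrow> real) set" where
  "bar_C2 G = free_real_space (carrier G \<times> carrier G)"

definition bar_boundary :: "('a, 'b) monoid_scheme \<Rightarrow> ('a \<times> 'a \<Rightarrow> real) \<Rightarrow> 'a \<Rightarrow> real" where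
  "bar_boundary G c =
     (\<lambda>x. \<Sum>(g, h) \<in> {p. c p \<noteq> 0}.
        c (g, h) * (basis_vector g x - basis_vector (g \<otimes>\<^bsub>G\<^esub> h) x + basis_vector h x))"

definition bar_B1 :: "('a, 'b) monoid_scheme \<Rightarrow> ('a \<Rightarrow> real) set" where
  "bar_B1 G = bar_boundary G ` bar_C2 G"

section \<open>Stable commutator length\<close>

definition scl_ratios :: "('a, 'b) monoid_scheme \<Rightarrow> 'a \<Rightarrow> ereal set" where
  "scl_ratios G g =
     {ereal (\<phi> g / (2 * defect G \<phi>)) | \<phi>. homogeneous_quasimorphism G \<phi> \<and> defect G \<phi> > 0}"

text \<open>The empty case is separated because the supremum of the empty set in \<open>ereal\<close> is \<open>-\<infinity>\<close>.\<close>

definition scl :: "('a, 'b) monoid_scheme \<Rightarrow> 'a \<Rightarrow> ereal" where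
  "scl G g =
     (if basis_vector g \<in> bar_B1 G
      then (if scl_ratios G g = {} then 0 else Sup (scl_ratios G g))
      else \<infinity>)"

section \<open>Conjugacy\<close>

definition conjugate_in :: "('a, 'b) monoid_scheme \<Rightarrow> 'a \<Rightarrow> 'a \<Rightarrow> bool" where
  "conjugate_in G x y \<longleftrightarrow> (\<exists>h\<in>carrier G. h \<otimes>\<^bsub>G\<^esub> x \<otimes>\<^bsub>G\<^esub> inv\<^bsub>G\<^esub> h = y)"

end

theory Submission
  imports Defs "HOL-Library.Sublist"
begin

text \<open>
  If \<open>g\<^sup>n\<close> is conjugate to its inverse for some \<open>n > 0\<close>, then in 1-chains modulo boundaries, where
  powers are multiples and conjugate elements agree, \<open>2n\<cdot>g = 0\<close>, so \<open>g\<close> is a boundary; and every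
  homogeneous quasimorphism, being constant on conjugacy classes, vanishes at \<open>g\<close>. This gives
  \<open>scl g = 0\<close> (\<open>scl_eq_0_if_conj_inverse_power\<close>).

  Otherwise it suffices to find a homogeneous quasimorphism \<open>\<phi>\<close> of defect at most \<open>4d\<close> with
  \<open>\<phi> g \<ge> 1\<close>: if \<open>g\<close> is a boundary, \<open>\<phi>\<close> is no homomorphism and witnesses \<open>scl g \<ge> 1/(8d)\<close>
  (\<open>scl_ge\<close>). It arises from a counting quasimorphism on the free subgroup \<open>H\<close> in two steps, with
  two constants \<open>2\<close> and one factor \<open>d\<close>.

  On \<open>H\<close>, count the occurrences of a word \<open>u\<close> in reduced words and subtract those of its inverse.
  The reduced words of \<open>x\<close>, \<open>y\<close>, \<open>xy\<close> form a tripod, so the defect only sees occurrences of \<open>u\<close>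
  across the three junctions of legs. If \<open>u\<close> is unbordered, each junction carries at most one in
  each direction around the tripod, and the three junctions cannot all carry one in the same
  direction, so the defect is at most \<open>2\<close> (\<open>signed_count_defect\<close>). Summing the function over the \<open>d\<close> cosets of \<open>H\<close>, by the cocycle
  that describes the action on coset representatives, gives an antisymmetric function on the whole
  group of defect at most \<open>2d\<close> (\<open>transfer_quasimorphism\<close>). Homogenizing at most doubles the defect
  of an antisymmetric function (\<open>homogenization_almost_additive\<close>), because \<open>(ab)\<^sup>2\<^sup>k\<close> and
  \<open>a\<^sup>2\<^sup>k b\<^sup>2\<^sup>k\<close> differ by only \<open>k\<close> commutators (\<open>even_power_of_product\<close>).

  For the value at \<open>g\<close>, let \<open>v\<^sub>C\<close> be the first power of \<open>g\<close> that fixes the coset \<open>C\<close>, conjugated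
  into \<open>H\<close> by the representative of \<open>C\<close>. The homogenized transfer at \<open>g\<close> is a combination of the
  homogenized values at the \<open>v\<^sub>C\<close> with nonnegative coefficients, and the orbit of one coset \<open>C\<close>
  contributes its \<open>v\<^sub>C\<close> with total weight \<open>1\<close>. So \<open>u\<close> should occur in the powers of some cyclically
  reduced \<open>v\<^sub>C\<close>, while its inverse occurs in the powers of none. Regard the powers of
  \<open>v\<^sub>C\<close> as one periodic infinite word, take \<open>C\<close> whose word has the largest least period \<open>p\<close>, and let
  \<open>u\<close> be the Lyndon word among its subwords of length \<open>p\<close>; it is unbordered
  (\<open>unbordered_factor_exists\<close>). If the inverse of \<open>u\<close> occurs in the word of \<open>v\<^sub>C\<^sub>'\<close>, then that word
  has least period exactly \<open>p\<close>, so a power of \<open>v\<^sub>C\<close> is conjugate to an inverse power of \<open>v\<^sub>C\<^sub>'\<close>.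
  Hence \<open>g\<^sup>i\<close> is conjugate to the inverse of \<open>g\<^sup>j\<close> for some \<open>i, j > 0\<close>. Comparing word lengths in
  \<open>H\<close> forces \<open>i = j\<close> (\<open>conj_inverse_exponents_eq\<close>), contrary to the assumption on \<open>g\<close>.
\<close>

section \<open>Reduced words\<close>

definition letter_inv :: "'a \<times> bool \<Rightarrow> 'a \<times> bool" where
  "letter_inv l = (fst l, \<not> snd l)"

definition word_inv :: "('a \<times> bool) list \<Rightarrow> ('a \<times> bool) list" where
  "word_inv w = rev (map letter_inv w)"

lemma letter_inv_involution [simp]: "letter_inv (letter_inv l) = l"
  by (simp add: letter_inv_def)

lemma letter_inv_neq [simp]: "letter_inv l \<noteq> l" "l \<noteq> letter_inv l"
  by (cases l; simp add: letter_inv_def)+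

lemma word_inv_simps [simp]:
  "word_inv [] = []"
  "word_inv (l # w) = word_inv w @ [letter_inv l]"
  "word_inv (v @ w) = word_inv w @ word_inv v"
  "word_inv (word_inv w) = w"
  "length (word_inv w) = length w"
  "word_inv w = [] \<longleftrightarrow> w = []"
  by (simp_all add: word_inv_def rev_map o_def)

lemma word_inv_eq_iff: "word_inv v = w \<longleftrightarrow> v = word_inv w"
  by auto

lemma word_inv_inject [simp]: "word_inv v = word_inv w \<longleftrightarrow> v = w"
  by (metis word_inv_simps(4))

lemma word_inv_in_lists [simp]: "word_inv w \<in> lists (S \<times> UNIV) \<longleftrightarrow> w \<in> lists (S \<times> UNIV)"
  by (induction w) (auto simp: letter_inv_def)

lemma reduced_word_Nil [simp]: "reduced_word []"
  by (simp add: reduced_word_def)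

lemma reduced_word_Cons:
  "reduced_word (l # w) \<longleftrightarrow> reduced_word w \<and> (w = [] \<or> hd w \<noteq> letter_inv l)"
  by (cases w; cases l) (auto simp: reduced_word_def letter_inv_def prod_eq_iff)

lemma reduced_word_append:
  "reduced_word (v @ w) \<longleftrightarrow>
     reduced_word v \<and> reduced_word w \<and> (v = [] \<or> w = [] \<or> hd w \<noteq> letter_inv (last v))"
  by (induction v) (auto simp: reduced_word_Cons)

lemma reduced_word_inv [simp]: "reduced_word (word_inv w) \<longleftrightarrow> reduced_word w"
proof -
  have *: "reduced_word (word_inv w)" if "reduced_word w" for w :: "('b \<times> bool) list"
    using that
  proof (induction w)
    case (Cons l w)
    then show ?case
      by (cases w) (auto simp: reduced_word_append reduced_word_Cons)
  qed simp
  show ?thesis using *[of w] *[of "word_inv w"] by auto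
qed

text \<open>
  Read from both ends inwards, such a word has in its middle either a letter that is its own
  inverse or two adjacent letters that are inverse to each other.
\<close>

lemma reduced_self_inverse_word:
  assumes "reduced_word w" "word_inv w = w"
  shows "w = []"
  using assms
proof (induction "length w" arbitrary: w rule: less_induct)
  case less
  show ?case
  proof (cases w)
    case (Cons l v)
    show ?thesis
    proof (cases v rule: rev_cases)
      case Nil
      then show ?thesis using less.prems Cons by simp
    next
      case (snoc v' l')
      have w: "w = l # v' @ [l']" using Cons snoc by simp
      have eq: "letter_inv l' = l" "word_inv v' = v'"
        using less.prems(2) unfolding w by auto
      have red: "reduced_word v'"
        using less.prems(1) unfolding w by (auto simp: reduced_word_Cons reduced_word_append)
      have "v' = []" using less.hyps[of v'] red eq w by simp
      then show ?thesis
        using less.prems(1) eq(1) unfolding w by (auto simp: reduced_word_Cons)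
    qed
  qed simp
qed

text \<open>
  The words of \<open>x\<close>, \<open>y\<close> and \<open>xy\<close> are the sides of a tripod with legs \<open>a\<close>, \<open>b\<close>, \<open>c\<close>, where \<open>b\<close> is
  the part that cancels. This makes the defect of a counting function a matter of three junctions.
\<close>

lemma reduced_product_decomposition:
  assumes "reduced_word x" "reduced_word y"
  obtains a b c where "x = a @ b" "y = word_inv b @ c" "reduced_word (a @ c)"
  using assms
proof (induction x arbitrary: y thesis rule: rev_induct)
  case Nil
  show ?case by (rule Nil.prems(1)[of "[]" "[]" y]) (use Nil.prems in auto)
next
  case (snoc l x)
  show ?case
  proof (cases "y \<noteq> [] \<and> hd y = letter_inv l")
    case True
    then obtain y' where y: "y = letter_inv l # y'" by (cases y) auto
    have "reduced_word x" "reduced_word y'"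
      using snoc.prems unfolding y by (auto simp: reduced_word_append reduced_word_Cons)
    then obtain a b c where "x = a @ b" "y' = word_inv b @ c" "reduced_word (a @ c)"
      using snoc.IH by blast
    then show ?thesis
      using snoc.prems(1)[of a "b @ [l]" c] y by simp
  next
    case False
    then show ?thesis
      using snoc.prems(1)[of "x @ [l]" "[]" y] snoc.prems(2,3)
      by (auto simp: reduced_word_append reduced_word_Cons)
  qed
qed

text \<open>
  Mutually inverse first and last letters are stripped off one pair at a time. Cyclic reducedness
  is expressed by \<open>r @ r\<close> because this form includes the empty word.
\<close>

lemma cyclic_reduction:
  assumes "reduced_word x"
  obtains y r where "x = y @ r @ word_inv y" "reduced_word (r @ r)"
  using assms
proof (induction "length x" arbitrary: x thesis rule: less_induct)
  case less
  show ?case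
  proof (cases "reduced_word (x @ x)")
    case True
    then show ?thesis using less.prems(1)[of "[]" x] by simp
  next
    case False
    then have x: "x \<noteq> []" "hd x = letter_inv (last x)"
      using less.prems(2) by (auto simp: reduced_word_append)
    then obtain l v where lv: "x = l # v" by (cases x) auto
    have "v \<noteq> []" using x lv by auto
    then obtain v' l' where v': "v = v' @ [l']" by (cases v rule: rev_cases) auto
    have x': "x = [l] @ v' @ word_inv [l]"
      using x lv v' by simp
    have "reduced_word v'" "length v' < length x"
      using less.prems(2) x' by (auto simp: reduced_word_append reduced_word_Cons)
    then obtain y r where "v' = y @ r @ word_inv y" "reduced_word (r @ r)"
      using less.hyps by blast
    then show ?thesis
      using less.prems(1)[of "l # y" r] x' by simp
  qed
qed

lemma reduced_power:
  assumes "reduced_word (r @ r)"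
  shows "reduced_word (concat (replicate n r))"
proof (induction n)
  case (Suc n)
  then show ?case
    using assms by (cases n) (auto simp: reduced_word_append)
qed simp

section \<open>Counting an unbordered word\<close>

text \<open>
  Distinct occurrences of such a word in another word never overlap.
\<close>

definition unbordered :: "'a list \<Rightarrow> bool" where
  "unbordered u \<longleftrightarrow> u \<noteq> [] \<and> (\<forall>v. prefix v u \<and> suffix v u \<longrightarrow> v = [] \<or> v = u)"

definition occurrences :: "'a list \<Rightarrow> 'a list \<Rightarrow> nat" where
  "occurrences u x = card {i. i < length x \<and> prefix u (drop i x)}"

text \<open>
  The starting positions of the occurrences of \<open>u\<close> in \<open>x @ y\<close> that lie neither in \<open>x\<close> nor in \<open>y\<close>.
\<close>

definition crossings :: "'a list \<Rightarrow> 'a list \<Rightarrow> 'a list \<Rightarrow> nat set" where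
  "crossings u x y = {i. i < length x \<and> (\<exists>v. v \<noteq> [] \<and> u = drop i x @ v \<and> prefix v y)}"

lemma occurrences_append:
  "occurrences u (x @ y) = occurrences u x + occurrences u y + card (crossings u x y)"
proof -
  define A where "A = {i. i < length x \<and> prefix u (drop i x)}"
  define B where "B = {i. i < length y \<and> prefix u (drop i y)}"
  define C where "C = crossings u x y"
  have fin: "finite A" "finite B" "finite C"
    by (auto simp: A_def B_def C_def crossings_def)
  have "{i. i < length (x @ y) \<and> prefix u (drop i (x @ y))} = (A \<union> C) \<union> (+) (length x) ` B"
    (is "?L = ?R")
  proof (intro equalityI subsetI)
    fix i assume i: "i \<in> ?L"
    show "i \<in> ?R"
    proof (cases "i < length x")
      case True
      then have "prefix u (drop i x @ y)" using i by simp
      then have "prefix u (drop i x) \<or> (\<exists>v. v \<noteq> [] \<and> u = drop i x @ v \<and> prefix v y)"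
        by (auto simp: prefix_append)
      then show ?thesis using True unfolding A_def C_def crossings_def by blast
    next
      case False
      then have "i - length x \<in> B" "i = length x + (i - length x)"
        using i by (auto simp: B_def)
      then show ?thesis by blast
    qed
  next
    fix i assume "i \<in> ?R"
    then consider "i \<in> A" | "i \<in> C" | j where "j \<in> B" "i = length x + j" by blast
    then show "i \<in> ?L"
      by cases (auto simp: A_def B_def C_def crossings_def)
  qed
  moreover have "A \<inter> C = {}"
    by (auto simp: A_def C_def crossings_def)
  moreover have "(A \<union> C) \<inter> (+) (length x) ` B = {}"
    by (auto simp: A_def C_def crossings_def)
  ultimately show ?thesis
    using fin
    by (simp add: occurrences_def card_Un_disjoint card_image A_def[symmetric]
        B_def[symmetric] C_def[symmetric])
qed

lemma crossingsE:
  assumes "i \<in> crossings u x y"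
  obtains v where "i < length x" "v \<noteq> []" "u = drop i x @ v" "prefix v y"
  using assms unfolding crossings_def mem_Collect_eq by (elim conjE exE) (rule that)

text \<open>
  Two crossing occurrences of \<open>u\<close> overlap around the junction, and an overlap is a border of \<open>u\<close>.
\<close>

lemma card_crossings_unbordered:
  assumes "unbordered u"
  shows "card (crossings u x y) \<le> 1"
proof -
  have False if i_in: "i \<in> crossings u x y" and j_in: "j \<in> crossings u x y" and "i < j" for i j
  proof -
    obtain v where v: "v \<noteq> []" "u = drop i x @ v" "prefix v y"
      using i_in by (rule crossingsE)
    obtain w where w: "w \<noteq> []" "u = drop j x @ w" "prefix w y" and j: "j < length x"
      using j_in by (rule crossingsE)
    define z where "z = take (j - i) (drop i x)"
    have z: "drop i x = z @ drop j x"
      unfolding z_def using \<open>i < j\<close> append_take_drop_id[of "j - i" "drop i x"] by simp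
    have "z \<noteq> []" using \<open>i < j\<close> j by (simp add: z_def)
    have "length v \<le> length w"
      using arg_cong[OF v(2), of length] arg_cong[OF w(2), of length] j \<open>i < j\<close> by simp
    then have "prefix v w" using v(3) w(3) prefix_length_prefix by blast
    then have "prefix (drop j x @ v) u" using w(2) by simp
    moreover have "suffix (drop j x @ v) u" using v(2) z by (simp add: suffix_def)
    moreover have "drop j x @ v \<noteq> u" using v(2) z \<open>z \<noteq> []\<close> by simp
    ultimately show False using assms v(1) by (auto simp: unbordered_def)
  qed
  then have "\<forall>i\<in>crossings u x y. \<forall>j\<in>crossings u x y. i = j"
    by (meson linorder_neqE_nat)
  moreover have "finite (crossings u x y)"
    by (simp add: crossings_def)
  ultimately show ?thesis
    by (simp add: card_le_Suc0_iff_eq)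
qed

text \<open>
  Suppose that \<open>u\<close> crosses the junction of \<open>a\<close> and \<open>b\<close>, where it is cut as \<open>u1 @ u2\<close>, and the junction
  of the inverse of \<open>b\<close> and \<open>c\<close>, where it is cut as \<open>v1 @ v2\<close>. Along \<open>b\<close> one then reads both \<open>u2\<close> and the
  inverse of \<open>v1\<close>. If the second cut did not come before the first one, the part \<open>s\<close> of \<open>u\<close> between
  the cuts would be its own inverse, hence empty; and if both cuts are equal, the letters on the two
  sides of the cut are inverse to each other.
\<close>

lemma crossing_cuts_decrease:
  assumes "reduced_word u"
    and u: "u = u1 @ u2" "u2 \<noteq> []" "prefix u2 b"
    and v: "u = v1 @ v2" "v1 \<noteq> []" "prefix (word_inv v1) b"
    and "u1 \<noteq> []"
  shows "length v1 < length u1"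
proof (rule ccontr)
  assume "\<not> ?thesis"
  then obtain s where s: "v1 = u1 @ s" "u2 = s @ v2"
    using u(1) v(1) by (auto simp: append_eq_append_conv2)
  have "reduced_word s"
    using assms(1) u(1) s(2) by (auto simp: reduced_word_append)
  have 1: "prefix (word_inv s @ word_inv u1) b" "prefix (s @ v2) b"
    using v(3) u(3) s by auto
  then have "prefix (word_inv s) b" "prefix s b"
    by (auto dest: append_prefixD)
  then have "prefix (word_inv s) s" "prefix s (word_inv s)"
    using prefix_length_prefix[of "word_inv s" b s] prefix_length_prefix[of s b "word_inv s"]
    by (metis order.refl word_inv_simps(5))+
  then have "word_inv s = s" by (rule prefix_order.antisym)
  then have "s = []" using reduced_self_inverse_word \<open>reduced_word s\<close> by blast
  then have 2: "prefix (word_inv u1) b" "prefix u2 b" "u2 = v2" using 1 s by auto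
  have "b \<noteq> []" using 2 u(2) by auto
  obtain v l where vl: "u1 = v @ [l]"
    using \<open>u1 \<noteq> []\<close> by (cases u1 rule: rev_cases) auto
  obtain l' w where lw: "u2 = l' # w"
    using u(2) by (cases u2) auto
  have "l' = letter_inv l"
    using 2(1,2) by (cases b) (auto simp: vl lw)
  then show False
    using assms(1) u(1) by (simp add: vl lw reduced_word_append reduced_word_Cons)
qed

text \<open>
  The three cuts of \<open>u\<close> would move strictly to the left all the way around the tripod.
\<close>

lemma no_triple_crossing:
  assumes "reduced_word u"
    and "crossings u a b \<noteq> {}" "crossings u (word_inv b) c \<noteq> {}"
    and "crossings u (word_inv c) (word_inv a) \<noteq> {}"
  shows False
proof -
  have cut: "\<exists>u1 u2. u = u1 @ u2 \<and> u1 \<noteq> [] \<and> u2 \<noteq> [] \<and> prefix (word_inv u1) (word_inv x) \<and> prefix u2 y"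
    if crossing: "crossings u x y \<noteq> {}" for x y
  proof -
    obtain i v where i: "i < length x" "v \<noteq> []" "u = drop i x @ v" "prefix v y"
      using crossing by (meson crossingsE equals0I)
    have "word_inv x = word_inv (drop i x) @ word_inv (take i x)"
      by (metis append_take_drop_id word_inv_simps(3))
    then have "prefix (word_inv (drop i x)) (word_inv x)" by simp
    then show ?thesis using i by (intro exI[of _ "drop i x"] exI[of _ v]) auto
  qed
  obtain u1 u2 where u: "u = u1 @ u2" "u1 \<noteq> []" "u2 \<noteq> []" "prefix (word_inv u1) (word_inv a)" "prefix u2 b"
    using cut[OF assms(2)] by blast
  obtain v1 v2 where v: "u = v1 @ v2" "v1 \<noteq> []" "v2 \<noteq> []" "prefix (word_inv v1) b" "prefix v2 c"
    using cut[OF assms(3)] by auto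
  obtain w1 w2 where w: "u = w1 @ w2" "w1 \<noteq> []" "w2 \<noteq> []" "prefix (word_inv w1) c" "prefix w2 (word_inv a)"
    using cut[OF assms(4)] by auto
  have "length v1 < length u1"
    using crossing_cuts_decrease[OF assms(1) u(1,3,5) v(1,2,4) u(2)] .
  moreover have "length w1 < length v1"
    using crossing_cuts_decrease[OF assms(1) v(1,3,5) w(1,2,4) v(2)] .
  moreover have "length u1 < length w1"
    using crossing_cuts_decrease[OF assms(1) w(1,3,5) u(1,2,4) w(2)] .
  ultimately show False by simp
qed

text \<open>
  The Brooks counting function of \<open>u\<close>: occurrences of \<open>u\<close> in the inverse of \<open>x\<close> correspond to
  occurrences of the inverse of \<open>u\<close> in \<open>x\<close>.
\<close>

definition signed_count :: "('a \<times> bool) list \<Rightarrow> ('a \<times> bool) list \<Rightarrow> real" where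
  "signed_count u x = real (occurrences u x) - real (occurrences u (word_inv x))"

lemma signed_count_inv: "signed_count u (word_inv x) = - signed_count u x"
  by (simp add: signed_count_def)

text \<open>
  The counts within the legs of the tripod cancel. What remains are the crossings met when going
  around the tripod in one direction minus those met in the other direction, and by
  \<open>no_triple_crossing\<close> each direction meets at most two.
\<close>

lemma signed_count_defect:
  assumes "reduced_word u" "unbordered u"
  shows "\<bar>signed_count u (a @ c) - signed_count u (a @ b) - signed_count u (word_inv b @ c)\<bar> \<le> 2"
proof -
  define k where "k x y = card (crossings u x y)" for x y
  have le: "k x y \<le> 1" for x y
    using card_crossings_unbordered[OF assms(2)] by (simp add: k_def)
  have pos: "crossings u x y \<noteq> {}" if "k x y \<noteq> 0" for x y
    using that by (auto simp: k_def)
  have 1: "k a b = 0 \<or> k (word_inv b) c = 0 \<or> k (word_inv c) (word_inv a) = 0"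
    using no_triple_crossing[OF assms(1) pos pos pos] by blast
  then have "k a b + k (word_inv b) c + k (word_inv c) (word_inv a) \<le> 2"
    using le[of a b] le[of "word_inv b" c] le[of "word_inv c" "word_inv a"] by linarith
  then have A: "real (k a b) + real (k (word_inv b) c) + real (k (word_inv c) (word_inv a)) \<le> 2"
    by linarith
  have "k a c = 0 \<or> k (word_inv c) b = 0 \<or> k (word_inv b) (word_inv a) = 0"
    using no_triple_crossing[OF assms(1), of a c b] pos by blast
  then have "k a c + k (word_inv c) b + k (word_inv b) (word_inv a) \<le> 2"
    using le[of a c] le[of "word_inv c" b] le[of "word_inv b" "word_inv a"] by linarith
  then have B: "real (k a c) + real (k (word_inv c) b) + real (k (word_inv b) (word_inv a)) \<le> 2"
    by linarith
  have "signed_count u (a @ c) - signed_count u (a @ b) - signed_count u (word_inv b @ c)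
    = (real (k a c) + real (k (word_inv c) b) + real (k (word_inv b) (word_inv a)))
    - (real (k a b) + real (k (word_inv b) c) + real (k (word_inv c) (word_inv a)))"
    by (simp add: signed_count_def occurrences_append k_def)
  then show ?thesis
    using A B by linarith
qed

section \<open>Periodic words and their unbordered factors\<close>

definition periodic_word :: "'a list \<Rightarrow> nat \<Rightarrow> 'a" where
  "periodic_word r n = r ! (n mod length r)"

definition window :: "(nat \<Rightarrow> 'a) \<Rightarrow> nat \<Rightarrow> nat \<Rightarrow> 'a list" where
  "window R s n = map (\<lambda>i. R (s + i)) [0..<n]"

definition period :: "(nat \<Rightarrow> 'a) \<Rightarrow> nat \<Rightarrow> bool" where
  "period R p \<longleftrightarrow> p > 0 \<and> (\<forall>n. R (n + p) = R n)"

definition least_period :: "(nat \<Rightarrow> 'a) \<Rightarrow> nat" where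
  "least_period R = (LEAST p. period R p)"

lemma length_window [simp]: "length (window R s n) = n"
  by (simp add: window_def)

lemma nth_window [simp]: "i < n \<Longrightarrow> window R s n ! i = R (s + i)"
  by (simp add: window_def)

lemma window_add: "window R s (m + n) = window R s m @ window R (s + m) n"
  by (rule nth_equalityI) (auto simp: nth_append)

lemma period_mult: "period R p \<Longrightarrow> R (n + k * p) = R n"
  by (induction k) (auto simp: period_def add.assoc[symmetric] add.commute[of p])

lemma window_period_shift: "period R p \<Longrightarrow> window R (s + k * p) n = window R s n"
  using period_mult[of R p "s + i" k for i]
  by (intro nth_equalityI) (simp_all add: add.assoc add.left_commute add.commute)

lemma window_power:
  assumes "period R p"
  shows "window R s (k * p) = concat (replicate k (window R s p))"
proof (induction k)
  case (Suc k)
  then show ?case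
    using window_period_shift[OF assms, of s 1 "k * p"] by (simp add: window_add)
qed (simp add: window_def)

lemma least_period:
  assumes "period R p"
  shows "period R (least_period R)" "least_period R \<le> p"
  using assms unfolding least_period_def by (auto intro: LeastI Least_le)

lemma period_periodic_word: "r \<noteq> [] \<Longrightarrow> period (periodic_word r) (length r)"
  by (simp add: period_def periodic_word_def)

lemma window_periodic_word:
  "window (periodic_word r) 0 (k * length r) = concat (replicate k r)"
proof (cases "r = []")
  case False
  have "window (periodic_word r) 0 (length r) = r"
    by (rule nth_equalityI) (auto simp: periodic_word_def)
  then show ?thesis
    using window_power[OF period_periodic_word[OF False], of 0 k] by simp
qed (simp add: window_def)

lemma reduced_window:
  assumes "reduced_word (r @ r)" "r \<noteq> []"
  shows "reduced_word (window (periodic_word r) s n)"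
proof -
  have "s + n \<le> (s + n) * length r"
    using assms(2) by (cases r) auto
  then obtain k where "(s + n) * length r = s + (n + k)"
    by (metis add.assoc le_iff_add)
  then have "concat (replicate (s + n) r)
      = window (periodic_word r) 0 s @ window (periodic_word r) s n
        @ window (periodic_word r) (s + n) k"
    by (metis window_periodic_word window_add add_0)
  then show ?thesis
    using reduced_power[OF assms(1), of "s + n"] by (simp add: reduced_word_append)
qed

lemma window_in_lists:
  assumes "r \<in> lists A" "r \<noteq> []"
  shows "window (periodic_word r) s n \<in> lists A"
proof -
  have "r ! (k mod length r) \<in> A" for k
    using nth_mem[of "k mod length r" r] assms by (auto simp: in_lists_conv_set)
  then show ?thesis by (auto simp: window_def periodic_word_def in_lists_conv_set)
qed

lemma lex_total:
  assumes "total r" "length x = length y" "x \<noteq> y"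
  shows "(x, y) \<in> lex r \<or> (y, x) \<in> lex r"
  using assms(2,3)
proof (induction x y rule: list_induct2)
  case (Cons a x b y)
  then show ?case using assms(1) by (auto simp: total_on_def)
qed simp

lemma wf_total_relation_exists:
  obtains r :: "'a rel" where "wf r" "total r"
proof -
  obtain r :: "'a rel" where "well_order_on UNIV r" using well_order_on by blast
  then have "wf (r - Id)" "total (r - Id)"
    by (auto simp: well_order_on_def linear_order_on_def total_on_def)
  then show ?thesis using that by blast
qed

text \<open>
  The window \<open>u\<close> of least-period length that is lexicographically minimal for some well-founded total
  order of the letters is a Lyndon word, and those have no border: if \<open>u = v @ y = x @ v\<close>, the windows
  starting \<open>length x\<close> and \<open>length v\<close> places later read \<open>v @ x\<close> and \<open>y @ v\<close>, so by minimality neither of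
  \<open>x\<close>, \<open>y\<close> precedes the other. Hence \<open>x = y\<close>, which makes \<open>length x\<close> a period shorter than the
  least one.
\<close>

lemma unbordered_factor_exists:
  assumes "period R p0"
  obtains s where "unbordered (window R s (least_period R))"
proof -
  define p where "p = least_period R"
  have p: "period R p" and p_pos: "p > 0"
    using least_period[OF assms] by (auto simp: p_def period_def)
  obtain r :: "'a rel" where r: "wf r" "total r" using wf_total_relation_exists .
  have "\<exists>x\<in>range (\<lambda>s. window R s p). \<forall>y. (y, x) \<in> lex r \<longrightarrow> y \<notin> range (\<lambda>s. window R s p)"
    using wf_lex[OF r(1)] unfolding wf_eq_minimal by (metis empty_iff rangeI)
  then obtain s where min: "(window R t p, window R s p) \<notin> lex r" for t
    by blast
  define u where "u = window R s p"
  have False if v: "prefix v u" "suffix v u" "v \<noteq> []" "v \<noteq> u" for v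
  proof -
    obtain y where "u = v @ y" using v(1) by (rule prefixE)
    moreover obtain x where "u = x @ v" using v(2) by (rule suffixE)
    ultimately have xy: "u = v @ y" "u = x @ v" by auto
    define k where "k = length x"
    have len: "p = k + length v" "p = length v + k" "length y = k" "length x = k"
    proof -
      have "length u = p" by (simp add: u_def)
      then show "p = k + length v" "p = length v + k" "length y = k" "length x = k"
        using arg_cong[OF xy(1), of length] arg_cong[OF xy(2), of length] by (simp_all add: k_def)
    qed
    have k: "0 < k" "k < p" using v(3,4) xy len by auto
    have "window R s k @ window R (s + k) (length v) = x @ v"
      using xy(2) len(1) by (simp add: u_def window_add)
    then have split1: "window R s k = x" "window R (s + k) (length v) = v"
      using len(4) by (simp_all add: append_eq_append_conv)
    have "window R s (length v) @ window R (s + length v) k = v @ y"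
      using xy(1) len(2) by (simp add: u_def window_add)
    then have split2: "window R s (length v) = v" "window R (s + length v) k = y"
      by (simp_all add: append_eq_append_conv)
    have "window R (s + k) p = v @ x"
    proof -
      have "s + k + length v = s + 1 * p" using len by simp
      then have "window R (s + k + length v) k = x"
        using window_period_shift[OF p, of s 1 k] split1(1) by metis
      then show ?thesis using split1 len(2) by (simp add: window_add)
    qed
    then have "(v @ x, v @ y) \<notin> lex r" using min[of "s + k"] xy by (simp add: u_def)
    then have 1: "(x, y) \<notin> lex r" by (auto intro: lex_append_leftI)
    have "window R (s + length v) p = y @ v"
    proof -
      have "s + length v + k = s + 1 * p" using len by simp
      then have "window R (s + length v + k) (length v) = v"
        using window_period_shift[OF p, of s 1 "length v"] split2(1) by metis
      then show ?thesis using split2 len(1) by (simp add: window_add)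
    qed
    then have "(y @ v, x @ v) \<notin> lex r"
      using min[of "s + length v"] xy by (simp add: u_def)
    then have "(y, x) \<notin> lex r" using lex_append_rightI[of y x r v v] by blast
    then have "x = y" using lex_total[OF r(2)] 1 len by metis
    have shift: "window R (s + k) p = window R s p"
      using \<open>window R (s + k) p = v @ x\<close> \<open>x = y\<close> xy(1) by (simp add: u_def)
    have "R (n + k) = R n" for n
    proof -
      \<comment> \<open>\<open>shift\<close> only speaks about positions from \<open>s\<close> to \<open>s + p\<close>, so \<open>n\<close> is moved there modulo \<open>p\<close>.\<close>
      define i where "i = (n + s * p - s) mod p"
      have "s \<le> n + s * p" using p_pos by (cases p) auto
      then obtain q where q: "n + s * p = (s + i) + q * p"
        unfolding i_def by (metis add.assoc add.commute div_mult_mod_eq le_add_diff_inverse)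
      have i: "i < p" using p_pos by (simp add: i_def)
      have "R (n + k) = R (n + k + s * p)" using period_mult[OF p] by metis
      also have "\<dots> = R (s + k + i + q * p)" using q by (simp add: ac_simps)
      also have "\<dots> = R (s + k + i)" using period_mult[OF p] by metis
      also have "\<dots> = R (s + i)"
        using nth_window[OF i, of R "s + k"] nth_window[OF i, of R s] shift by simp
      also have "\<dots> = R (s + i + q * p)" using period_mult[OF p] by metis
      also have "\<dots> = R n" using q period_mult[OF p] by metis
      finally show ?thesis .
    qed
    then have "period R k" using k by (simp add: period_def)
    then show False using least_period(2) k p_def by fastforce
  qed
  moreover have "u \<noteq> []" using p_pos by (auto simp: u_def window_def)
  ultimately show ?thesis
    using that[of s] by (auto simp: unbordered_def u_def p_def)
qed

text \<open>
  The window without its first \<open>q\<close> letters equals the window without its last \<open>q\<close> letters.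
\<close>

lemma bordered_window:
  assumes "period R q" "q < n"
  shows "\<not> unbordered (window R s n)"
proof -
  have n: "n = q + (n - q)" "n = (n - q) + q" using assms(2) by auto
  have "prefix (window R s (n - q)) (window R s n)"
    using window_add[of R s "n - q" q] n(2) by (metis prefixI)
  moreover have "suffix (window R s (n - q)) (window R s n)"
    using window_add[of R s q "n - q"] window_period_shift[OF assms(1), of s 1 "n - q"] n(1)
    by (metis mult_1 suffixI)
  moreover have "window R s (n - q) \<noteq> []" "window R s (n - q) \<noteq> window R s n"
    using assms by (auto simp: period_def dest!: arg_cong[of _ _ length])
  ultimately show ?thesis by (auto simp: unbordered_def)
qed

lemma unbordered_inv: "unbordered (word_inv u) \<longleftrightarrow> unbordered u"
proof -
  have *: "unbordered (word_inv u)" if "unbordered u" for u :: "('b \<times> bool) list"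
  proof -
    have "v = [] \<or> v = word_inv u" if "prefix v (word_inv u)" "suffix v (word_inv u)" for v
    proof -
      have "prefix (word_inv v) u" "suffix (word_inv v) u"
        using that by (auto simp: prefix_def suffix_def word_inv_eq_iff)
      then show ?thesis using \<open>unbordered u\<close> by (auto simp: unbordered_def)
    qed
    then show ?thesis using \<open>unbordered u\<close> by (auto simp: unbordered_def)
  qed
  show ?thesis using *[of u] *[of "word_inv u"] by auto
qed

text \<open>
  Choose \<open>i\<close> such that the word of \<open>r i\<close> has the largest least period, and \<open>u\<close> as an unbordered window
  of that length. A word in which the inverse of \<open>u\<close> occurs cannot have a shorter period, since
  the inverse of \<open>u\<close> has no border either; by the choice of \<open>i\<close> its least period is not longer.
\<close>

lemma distinguishing_factor_exists:
  fixes r :: "'i \<Rightarrow> ('a \<times> bool) list"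
  assumes "finite I" "I \<noteq> {}"
    and r: "\<And>i. i \<in> I \<Longrightarrow> r i \<noteq> []" 
  obtains u i s where "i \<in> I" "unbordered u" "u = window (periodic_word (r i)) s (length u)"
    "period (periodic_word (r i)) (length u)"
    "\<And>j t. j \<in> I \<Longrightarrow> word_inv u = window (periodic_word (r j)) t (length u) \<Longrightarrow>
       period (periodic_word (r j)) (length u)"
proof -
  define L where "L i = least_period (periodic_word (r i))" for i
  have per: "period (periodic_word (r i)) (L i)" if "i \<in> I" for i
    using least_period(1)[OF period_periodic_word[OF r[OF that]]] by (simp add: L_def)
  have "Max (L ` I) \<in> L ` I" using assms(1,2) by simp
  then obtain i where i: "i \<in> I" "Max (L ` I) = L i" by auto
  then have max: "L j \<le> L i" if "j \<in> I" for j
    using that assms(1) by (metis Max_ge finite_imageI imageI)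
  obtain s where "unbordered (window (periodic_word (r i)) s (L i))"
    using unbordered_factor_exists[OF per[OF i(1)]] unfolding L_def by blast
  then obtain u where u: "u = window (periodic_word (r i)) s (L i)" "unbordered u" by blast
  then have len: "length u = L i" by simp
  show ?thesis
  proof (rule that[OF i(1) u(2)])
    show "u = window (periodic_word (r i)) s (length u)" using u(1) len by simp
    show "period (periodic_word (r i)) (length u)" using per[OF i(1)] len by simp
    fix j t assume j: "j \<in> I" "word_inv u = window (periodic_word (r j)) t (length u)"
    have "\<not> L j < length u"
      using bordered_window[OF per[OF j(1)]] j(2) u(2) unbordered_inv by metis
    then have "L j = length u" using max[OF j(1)] len by simp
    then show "period (periodic_word (r j)) (length u)" using per[OF j(1)] by simp
  qed
qed

text \<open>
  The occurrence at \<open>s\<close> reappears once in every period; the additional \<open>s + length u\<close> copies of \<open>r\<close>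
  leave room for the start and for the end of the last one.
\<close>

lemma occurrences_power_le:
  assumes "u = window (periodic_word r) s (length u)" "u \<noteq> []" "r \<noteq> []"
  shows "n \<le> occurrences u (concat (replicate (n + s + length u) r))"
proof -
  define z where "z = concat (replicate (n + s + length u) r)"
  have z: "z = window (periodic_word r) 0 ((n + s + length u) * length r)"
    by (simp add: z_def window_periodic_word)
  have "1 \<le> length r" using assms(3) by (cases r) auto
  have "(\<lambda>j. s + j * length r) ` {..<n} \<subseteq> {i. i < length z \<and> prefix u (drop i z)}"
  proof clarify
    fix j assume "j < n"
    have "j * length r + (s + length u) * 1 \<le> j * length r + (s + length u) * length r"
      using \<open>1 \<le> length r\<close> by (intro add_left_mono mult_left_mono) auto
    also have "\<dots> \<le> n * length r + (s + length u) * length r"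
      using \<open>j < n\<close> by (intro add_right_mono mult_right_mono) auto
    finally have "s + j * length r + length u \<le> (n + s + length u) * length r"
      by (simp add: algebra_simps)
    then obtain k where k: "(n + s + length u) * length r = (s + j * length r) + (length u + k)"
      by (metis add.assoc le_iff_add)
    have "z = window (periodic_word r) 0 (s + j * length r)
        @ u @ window (periodic_word r) (s + j * length r + length u) k"
      using window_add[of "periodic_word r" 0 "s + j * length r" "length u + k"]
        window_add[of "periodic_word r" "s + j * length r" "length u" k]
        window_period_shift[OF period_periodic_word[OF assms(3)], of s j "length u"]
        assms(1) unfolding z k by simp
    then show "s + j * length r < length z \<and> prefix u (drop (s + j * length r) z)"
      using assms(2) by simp
  qed
  then have "card ((\<lambda>j. s + j * length r) ` {..<n}) \<le> occurrences u z"
    unfolding occurrences_def by (intro card_mono) auto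
  moreover have "inj_on (\<lambda>j. s + j * length r) {..<n}"
    using assms(3) by (auto simp: inj_on_def)
  ultimately show ?thesis by (simp add: card_image z_def)
qed

lemma occurrences_eq_0_or_infix:
  "occurrences u x = 0 \<or> (\<exists>a c. x = a @ u @ c)"
proof (rule disjCI)
  assume no_infix: "\<nexists>a c. x = a @ u @ c"
  have "\<not> prefix u (drop i x)" for i
  proof
    assume "prefix u (drop i x)"
    then obtain c where "drop i x = u @ c" by (rule prefixE)
    then have "x = take i x @ u @ c" by (metis append_take_drop_id)
    then show False using no_infix by blast
  qed
  then show "occurrences u x = 0" by (simp add: occurrences_def)
qed

lemma infix_of_power:
  assumes "concat (replicate n r) = a @ u @ c"
  shows "u = window (periodic_word r) (length a) (length u)"
proof -
  have "n * length r = length a + (length u + length c)"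
    using arg_cong[OF assms, of length] by (simp add: length_concat sum_list_replicate)
  then have "a @ u @ c = window (periodic_word r) 0 (length a + (length u + length c))"
    using assms window_periodic_word[of r n] by simp
  then show ?thesis by (simp add: window_add append_eq_append_conv)
qed

section \<open>Conjugacy\<close>

context group
begin

lemma cancel_left [simp]:
  assumes "x \<in> carrier G" "y \<in> carrier G"
  shows "x \<otimes> (inv x \<otimes> y) = y" "inv x \<otimes> (x \<otimes> y) = y"
  using assms by (simp_all flip: m_assoc)

lemma conjugate_pow:
  assumes "h \<in> carrier G" "x \<in> carrier G"
  shows "(h \<otimes> x \<otimes> inv h) [^] (n::nat) = h \<otimes> x [^] n \<otimes> inv h"
  using assms by (induction n) (simp_all add: m_assoc)

lemma conjugate_in_sym:
  assumes "x \<in> carrier G" "conjugate_in G x y"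
  shows "conjugate_in G y x"
proof -
  obtain h where h: "h \<in> carrier G" "h \<otimes> x \<otimes> inv h = y"
    using assms(2) by (auto simp: conjugate_in_def)
  then have "inv h \<otimes> y \<otimes> inv (inv h) = x"
    using assms(1) by (auto simp: m_assoc)
  then show ?thesis using h(1) by (auto simp: conjugate_in_def intro!: bexI[of _ "inv h"])
qed

lemma conjugate_in_trans:
  assumes "x \<in> carrier G" "conjugate_in G x y" "conjugate_in G y z"
  shows "conjugate_in G x z"
proof -
  obtain h k where "h \<in> carrier G" "h \<otimes> x \<otimes> inv h = y" "k \<in> carrier G" "k \<otimes> y \<otimes> inv k = z"
    using assms(2,3) by (auto simp: conjugate_in_def)
  then have "(k \<otimes> h) \<otimes> x \<otimes> inv (k \<otimes> h) = z"
    using assms(1) by (auto simp: m_assoc inv_mult_group)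
  then show ?thesis
    using \<open>h \<in> carrier G\<close> \<open>k \<in> carrier G\<close> by (auto simp: conjugate_in_def intro!: bexI[of _ "k \<otimes> h"])
qed

lemma conjugate_in_pow:
  assumes "x \<in> carrier G" "conjugate_in G x y"
  shows "conjugate_in G (x [^] (n::nat)) (y [^] n)"
proof -
  obtain h where "h \<in> carrier G" "h \<otimes> x \<otimes> inv h = y"
    using assms(2) by (auto simp: conjugate_in_def)
  then show ?thesis using conjugate_pow[of h x n] assms(1) by (auto simp: conjugate_in_def)
qed

lemma conjugate_in_inv:
  assumes "x \<in> carrier G" "conjugate_in G x y"
  shows "conjugate_in G (inv x) (inv y)"
proof -
  obtain h where h: "h \<in> carrier G" "h \<otimes> x \<otimes> inv h = y"
    using assms(2) by (auto simp: conjugate_in_def)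
  then have "h \<otimes> inv x \<otimes> inv h = inv y"
    using assms(1) by (auto simp: m_assoc inv_mult_group)
  then show ?thesis using h(1) by (auto simp: conjugate_in_def)
qed

end

section \<open>Homogenization\<close>

definition homogenization :: "('a, 'b) monoid_scheme \<Rightarrow> ('a \<Rightarrow> real) \<Rightarrow> 'a \<Rightarrow> real" where
  "homogenization G \<phi> g = lim (\<lambda>n. \<phi> (g [^]\<^bsub>G\<^esub> n) / real n)"

text \<open>
  Antisymmetry makes \<open>\<phi>\<close> small on commutators: up to defects, the values of an element and of its
  inverse cancel.
\<close>

locale antisymmetric_quasimorphism = group G for G (structure) +
  fixes \<phi> :: "'a \<Rightarrow> real" and D :: real
  assumes defect_bound: "defect_bound G \<phi> D"
    and antisymmetric: "x \<in> carrier G \<Longrightarrow> \<phi> (inv x) = - \<phi> x"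
begin

lemma defect_nonneg: "D \<ge> 0"
  using defect_bound by (simp add: defect_bound_def)

lemma almost_additive:
  "x \<in> carrier G \<Longrightarrow> y \<in> carrier G \<Longrightarrow> \<bar>\<phi> (x \<otimes> y) - \<phi> x - \<phi> y\<bar> \<le> D"
  using defect_bound by (simp add: defect_bound_def)

lemma value_one [simp]: "\<phi> \<one> = 0"
  using antisymmetric[of \<one>] by simp

lemma almost_homogeneous:
  assumes "g \<in> carrier G"
  shows "\<bar>\<phi> (g [^] (m * n)) - real m * \<phi> (g [^] (n::nat))\<bar> \<le> real m * D"
proof (induction m)
  case (Suc m)
  have "g [^] (Suc m * n) = g [^] n \<otimes> g [^] (m * n)"
    using assms by (simp add: nat_pow_mult)
  then show ?case
    using Suc almost_additive[of "g [^] n" "g [^] (m * n)"] assms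
    by (simp add: algebra_simps abs_le_iff)
qed simp

text \<open>
  The quotient at \<open>m * n\<close> differs from that at \<open>n\<close> by at most \<open>D / n\<close> and from that at \<open>m\<close> by at most
  \<open>D / m\<close>, so the sequence is Cauchy.
\<close>

lemma homogenization_tendsto:
  assumes g: "g \<in> carrier G"
  shows "(\<lambda>n. \<phi> (g [^] n) / real n) \<longlonglongrightarrow> homogenization G \<phi> g"
proof -
  define f where "f n = \<phi> (g [^] n) / real n" for n :: nat
  have 1: "\<bar>f (m * n) - f n\<bar> \<le> D / real n" if "m > 0" "n > 0" for m n
  proof -
    have "f (m * n) - f n = (\<phi> (g [^] (m * n)) - real m * \<phi> (g [^] n)) / (real m * real n)"
      using that by (simp add: f_def field_simps)
    then have "\<bar>f (m * n) - f n\<bar>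
        = \<bar>\<phi> (g [^] (m * n)) - real m * \<phi> (g [^] n)\<bar> / (real m * real n)"
      by (simp add: abs_mult)
    also have "\<dots> \<le> (real m * D) / (real m * real n)"
      by (intro divide_right_mono almost_homogeneous g) simp
    finally show ?thesis using that by simp
  qed
  have 2: "\<bar>f m - f n\<bar> \<le> D / real m + D / real n" if "m > 0" "n > 0" for m n
    using 1[of m n] 1[of n m] that by (simp add: mult.commute)
  have "Cauchy f"
  proof (rule CauchyI)
    fix e :: real assume e: "e > 0"
    obtain N :: nat where N: "N > 0" "2 * D / e < real N"
      using reals_Archimedean2[of "max (2 * D / e) 1"] by (metis max_less_iff_conj of_nat_0_less_iff
          less_trans zero_less_one)
    have "norm (f m - f n) < e" if "N \<le> m" "N \<le> n" for m n
    proof -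
      have "D / real m \<le> D / real N" "D / real n \<le> D / real N"
        using N that defect_nonneg by (simp_all add: frac_le)
      moreover have "D / real N + D / real N < e"
        using N e by (simp add: field_simps)
      ultimately show ?thesis using 2[of m n] N that by simp
    qed
    then show "\<exists>M. \<forall>m\<ge>M. \<forall>n\<ge>M. norm (f m - f n) < e" by blast
  qed
  then have "convergent f" by (simp add: Cauchy_convergent_iff)
  then show ?thesis
    by (simp add: convergent_LIMSEQ_iff homogenization_def f_def[abs_def])
qed

lemma homogenization_subsequence:
  assumes "g \<in> carrier G" "k > 0"
  shows "(\<lambda>n. \<phi> (g [^] (k * n)) / real n) \<longlonglongrightarrow> real k * homogenization G \<phi> g"
proof -
  have "strict_mono (\<lambda>n. k * n)" using assms(2) by (simp add: strict_mono_def)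
  from LIMSEQ_subseq_LIMSEQ[OF homogenization_tendsto[OF assms(1)] this]
  have "(\<lambda>n. real k * (\<phi> (g [^] (k * n)) / real (k * n))) \<longlonglongrightarrow> real k * homogenization G \<phi> g"
    by (intro tendsto_mult tendsto_const) (simp add: o_def)
  then show ?thesis using assms(2) by (simp add: mult.assoc)
qed

lemma homogenization_nat_pow:
  assumes g: "g \<in> carrier G"
  shows "homogenization G \<phi> (g [^] (k::nat)) = real k * homogenization G \<phi> g"
proof (cases "k = 0")
  case True
  have "(\<lambda>n. \<phi> (\<one> [^] n) / real n) \<longlonglongrightarrow> 0" by simp
  then show ?thesis
    using True LIMSEQ_unique[OF homogenization_tendsto[of \<one>]] by simp
next
  case False
  have "(\<lambda>n. \<phi> ((g [^] k) [^] n) / real n) \<longlonglongrightarrow> real k * homogenization G \<phi> g"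
    using homogenization_subsequence[OF g, of k] False g by (simp add: nat_pow_pow)
  then show ?thesis
    using LIMSEQ_unique[OF homogenization_tendsto[of "g [^] k"]] g by simp
qed

lemma homogenization_inv:
  assumes g: "g \<in> carrier G"
  shows "homogenization G \<phi> (inv g) = - homogenization G \<phi> g"
proof -
  have "(\<lambda>n. \<phi> (inv g [^] n) / real n) = (\<lambda>n. - (\<phi> (g [^] n) / real n))"
    using g by (simp add: nat_pow_inv antisymmetric)
  then have "(\<lambda>n. \<phi> (inv g [^] n) / real n) \<longlonglongrightarrow> - homogenization G \<phi> g"
    using tendsto_minus[OF homogenization_tendsto[OF g]] by simp
  then show ?thesis
    using LIMSEQ_unique[OF homogenization_tendsto[of "inv g"]] g by simp
qed

lemma homogenization_int_pow:
  assumes "g \<in> carrier G"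
  shows "homogenization G \<phi> (g [^] (n::int)) = of_int n * homogenization G \<phi> g"
  using assms
  by (cases n rule: int_cases2)
    (simp_all add: int_pow_int int_pow_neg homogenization_nat_pow homogenization_inv)

lemma commutator_bound:
  assumes "s \<in> carrier G" "t \<in> carrier G"
  shows "\<bar>\<phi> (s \<otimes> t \<otimes> (inv s \<otimes> inv t))\<bar> \<le> 3 * D"
  using almost_additive[of "s \<otimes> t" "inv s \<otimes> inv t"] almost_additive[of s t]
    almost_additive[of "inv s" "inv t"] assms by (simp add: antisymmetric abs_le_iff)

text \<open>
  A lemma of Bavard: \<open>x\<close> is a product of \<open>k\<close> commutators. When \<open>k\<close> grows by one, \<open>x\<close> is conjugated and
  multiplied by \<open>y = a\<^sup>-\<^sup>2 b\<^sup>2\<^sup>k a b a b\<^sup>-\<^sup>2\<^sup>k b\<^sup>-\<^sup>1\<close>, a single commutator although the exponent of \<open>ab\<close> grows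
  by two. Each commutator costs \<open>3 * D\<close> and joining it to the product costs another \<open>D\<close>. The bound
  is stated for all conjugates of \<open>x\<close> so that it survives the conjugation.
\<close>

lemma even_power_of_product:
  assumes a: "a \<in> carrier G" and b: "b \<in> carrier G"
  shows "\<exists>x\<in>carrier G. (a \<otimes> b) [^] (2 * k) = a [^] (2 * k) \<otimes> x \<otimes> b [^] (2 * k) \<and>
           (\<forall>z\<in>carrier G. \<bar>\<phi> (z \<otimes> x \<otimes> inv z)\<bar> \<le> 4 * real k * D)"
proof (induction k)
  case 0
  show ?case by (rule bexI[of _ \<one>]) simp_all
next
  case (Suc k)
  then obtain x where x: "x \<in> carrier G" "(a \<otimes> b) [^] (2 * k) = a [^] (2 * k) \<otimes> x \<otimes> b [^] (2 * k)"
    and bound: "\<And>z. z \<in> carrier G \<Longrightarrow> \<bar>\<phi> (z \<otimes> x \<otimes> inv z)\<bar> \<le> 4 * real k * D" by blast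
  define A B where "A = a [^] (2 * k)" and "B = b [^] (2 * k)"
  have [simp]: "A \<in> carrier G" "B \<in> carrier G" using a b by (simp_all add: A_def B_def)
  have comm: "b \<otimes> B = B \<otimes> b" using nat_pow_comm[OF b, of 1 "2 * k"] b by (simp add: B_def)
  \<comment> \<open>A conjugate of \<open>q\<close> times a conjugate of \<open>inv q\<close> is a commutator.\<close>
  define p q c where "p = inv a" and "q = inv a \<otimes> B" and "c = b \<otimes> B"
  have [simp]: "p \<in> carrier G" "q \<in> carrier G" "c \<in> carrier G"
    using a b by (simp_all add: p_def q_def c_def)
  define y where "y = p \<otimes> q \<otimes> inv p \<otimes> (c \<otimes> inv q \<otimes> inv c)"
  define x' where "x' = p \<otimes> p \<otimes> x \<otimes> inv (p \<otimes> p) \<otimes> y"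
  have y: "y = inv a \<otimes> inv a \<otimes> B \<otimes> a \<otimes> b \<otimes> a \<otimes> inv B \<otimes> inv b"
    using a b by (simp add: y_def p_def q_def c_def m_assoc inv_mult_group)
  show ?case
  proof (intro bexI conjI ballI)
    show "x' \<in> carrier G" using x a b by (simp add: x'_def y_def)
    have AB: "a [^] (2 * Suc k) = A \<otimes> a \<otimes> a" "b [^] (2 * Suc k) = b \<otimes> B \<otimes> b"
      "(a \<otimes> b) [^] (2 * Suc k) = (A \<otimes> x \<otimes> B) \<otimes> (a \<otimes> b) \<otimes> (a \<otimes> b)"
      using x(2) comm by (simp_all add: A_def B_def)
    show "(a \<otimes> b) [^] (2 * Suc k) = a [^] (2 * Suc k) \<otimes> x' \<otimes> b [^] (2 * Suc k)"
      unfolding AB using a b x(1) by (simp add: x'_def y p_def m_assoc inv_mult_group)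
    fix z assume z: "z \<in> carrier G"
    define u v where "u = z \<otimes> p" and "v = z \<otimes> c"
    have [simp]: "u \<in> carrier G" "v \<in> carrier G" using z by (simp_all add: u_def v_def)
    define s t where "s = u \<otimes> q \<otimes> inv u" and "t = v \<otimes> inv u"
    have st[simp]: "s \<in> carrier G" "t \<in> carrier G" by (simp_all add: s_def t_def)
    have "z \<otimes> y \<otimes> inv z = s \<otimes> t \<otimes> (inv s \<otimes> inv t)"
      using z by (simp add: y_def s_def t_def u_def v_def m_assoc inv_mult_group)
    then have "\<bar>\<phi> (z \<otimes> y \<otimes> inv z)\<bar> \<le> 3 * D" using commutator_bound[of s t] by simp
    moreover have "\<bar>\<phi> ((z \<otimes> p \<otimes> p) \<otimes> x \<otimes> inv (z \<otimes> p \<otimes> p))\<bar> \<le> 4 * real k * D"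
      using z by (intro bound) simp
    moreover have "z \<otimes> x' \<otimes> inv z
        = ((z \<otimes> p \<otimes> p) \<otimes> x \<otimes> inv (z \<otimes> p \<otimes> p)) \<otimes> (z \<otimes> y \<otimes> inv z)"
      using z x(1) by (simp add: x'_def y_def m_assoc inv_mult_group)
    ultimately show "\<bar>\<phi> (z \<otimes> x' \<otimes> inv z)\<bar> \<le> 4 * real (Suc k) * D"
      using almost_additive[of "(z \<otimes> p \<otimes> p) \<otimes> x \<otimes> inv (z \<otimes> p \<otimes> p)" "z \<otimes> y \<otimes> inv z"]
        z x(1) by (simp add: y_def algebra_simps abs_le_iff)
  qed
qed

text \<open>
  Since the homogenization stays within \<open>D\<close> of \<open>\<phi>\<close>, the bound \<open>4 * D\<close> would be immediate. The factor
  \<open>2\<close> comes from evaluating at powers with exponent \<open>2 * k\<close>, where the error \<open>4 * k * D\<close> of Bavard's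
  lemma is divided by \<open>2 * k\<close>.
\<close>

lemma homogenization_almost_additive:
  assumes a: "a \<in> carrier G" and b: "b \<in> carrier G"
  shows "\<bar>homogenization G \<phi> (a \<otimes> b) - homogenization G \<phi> a - homogenization G \<phi> b\<bar> \<le> 2 * D"
    (is "\<bar>?h\<bar> \<le> _")
proof -
  define f where "f k = \<phi> ((a \<otimes> b) [^] (2 * k)) / real k - \<phi> (a [^] (2 * k)) / real k
    - \<phi> (b [^] (2 * k)) / real k" for k :: nat
  have "f \<longlonglongrightarrow> 2 * ?h"
    unfolding f_def right_diff_distrib
    using a b homogenization_subsequence[of _ 2] by (intro tendsto_diff) simp_all
  then have lim: "(\<lambda>k. \<bar>f k\<bar>) \<longlonglongrightarrow> \<bar>2 * ?h\<bar>" by (rule tendsto_rabs)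
  have "\<bar>f k\<bar> \<le> 4 * D + 2 * D / real k" if "k > 0" for k
  proof -
    obtain x where x: "x \<in> carrier G" "(a \<otimes> b) [^] (2 * k) = a [^] (2 * k) \<otimes> x \<otimes> b [^] (2 * k)"
      and bound: "\<forall>z\<in>carrier G. \<bar>\<phi> (z \<otimes> x \<otimes> inv z)\<bar> \<le> 4 * real k * D"
      using even_power_of_product[OF a b] by blast
    have "\<bar>\<phi> x\<bar> \<le> 4 * real k * D" using bspec[OF bound one_closed] x(1) by simp
    then have "\<bar>\<phi> ((a \<otimes> b) [^] (2 * k)) - \<phi> (a [^] (2 * k)) - \<phi> (b [^] (2 * k))\<bar>
        \<le> 4 * real k * D + 2 * D"
      using almost_additive[of "a [^] (2 * k)" x]
        almost_additive[of "a [^] (2 * k) \<otimes> x" "b [^] (2 * k)"] a b x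
      by (simp add: abs_le_iff)
    moreover have "f k = (\<phi> ((a \<otimes> b) [^] (2 * k)) - \<phi> (a [^] (2 * k)) - \<phi> (b [^] (2 * k))) / real k"
      by (simp add: f_def diff_divide_distrib)
    ultimately have "\<bar>f k\<bar> \<le> (4 * real k * D + 2 * D) / real k"
      by (simp add: divide_right_mono)
    then show ?thesis using that by (simp add: add_divide_distrib)
  qed
  then have "\<forall>\<^sub>F k in sequentially. \<bar>f k\<bar> \<le> 4 * D + 2 * D / real k"
    by (rule eventually_sequentiallyI[of 1]) simp
  moreover have "(\<lambda>k. 4 * D + 2 * D / real k) \<longlonglongrightarrow> 4 * D + 0"
    by (intro tendsto_add tendsto_const lim_const_over_n)
  ultimately have "\<bar>2 * ?h\<bar> \<le> 4 * D"
    using lim tendsto_le[OF sequentially_bot] by fastforce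
  then show ?thesis by (simp add: abs_mult)
qed

theorem homogenization_defect:
  "homogeneous_quasimorphism G (homogenization G \<phi>)"
  "defect_bound G (homogenization G \<phi>) (2 * D)"
proof -
  show bound: "defect_bound G (homogenization G \<phi>) (2 * D)"
    using homogenization_almost_additive defect_nonneg by (simp add: defect_bound_def)
  show "homogeneous_quasimorphism G (homogenization G \<phi>)"
    using bound homogenization_int_pow
    unfolding homogeneous_quasimorphism_def quasimorphism_def by blast
qed

end

text \<open>
  Conjugation changes the value at \<open>x\<^sup>n\<close> by at most \<open>2 * D\<close> for every \<open>n\<close>, while homogeneity multiplies
  any difference at \<open>x\<close> by \<open>n\<close>.
\<close>

lemma (in group) homogeneous_quasimorphism_conj:
  assumes "homogeneous_quasimorphism G \<phi>" "x \<in> carrier G" "conjugate_in G x y"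
  shows "\<phi> y = \<phi> x"
proof -
  obtain h where h: "h \<in> carrier G" "y = h \<otimes> x \<otimes> inv h"
    using assms(3) by (auto simp: conjugate_in_def)
  obtain D where "defect_bound G \<phi> D"
    using assms(1) by (auto simp: homogeneous_quasimorphism_def quasimorphism_def)
  then have D: "\<bar>\<phi> (g \<otimes> h) - \<phi> g - \<phi> h\<bar> \<le> D" if "g \<in> carrier G" "h \<in> carrier G" for g h
    using that by (simp add: defect_bound_def)
  have pow: "\<phi> (g [^] n) = of_int n * \<phi> g" if "g \<in> carrier G" for g and n :: int
    using assms(1) that by (simp add: homogeneous_quasimorphism_def)
  have inv: "\<phi> (inv h) = - \<phi> h"
    using pow[of h "-1"] h(1) by (simp add: int_pow_neg)
  have "real n * \<bar>\<phi> (h \<otimes> x \<otimes> inv h) - \<phi> x\<bar> \<le> 2 * D" for n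
  proof -
    have "\<phi> (h \<otimes> x [^] n \<otimes> inv h) = real n * \<phi> (h \<otimes> x \<otimes> inv h)"
      using pow[of "h \<otimes> x \<otimes> inv h" "int n"] assms h(1) conjugate_pow[of h x n] by (simp add: int_pow_int)
    moreover have "\<phi> (x [^] n) = real n * \<phi> x"
      using pow[of x "int n"] assms by (simp add: int_pow_int)
    ultimately have "\<bar>real n * \<phi> (h \<otimes> x \<otimes> inv h) - real n * \<phi> x\<bar> \<le> 2 * D"
      using D[of h "x [^] n"] D[of "h \<otimes> x [^] n" "inv h"] assms h(1) inv by (simp add: abs_le_iff)
    then show ?thesis by (simp add: abs_mult flip: right_diff_distrib)
  qed
  then have "\<bar>\<phi> (h \<otimes> x \<otimes> inv h) - \<phi> x\<bar> = 0"
    using real_archimedian_rdiv_eq_0[of "\<bar>\<phi> (h \<otimes> x \<otimes> inv h) - \<phi> x\<bar>" "2 * D"] by (metis abs_ge_zero mult_zero_left of_nat_0)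
  then show ?thesis by (simp add: h(2))
qed

section \<open>The boundaries of bar chains\<close>

lemma bar_boundary_eq_sum:
  assumes "finite A" "{p. c p \<noteq> 0} \<subseteq> A"
  shows "bar_boundary G c x = (\<Sum>(g, h)\<in>A.
    c (g, h) * (basis_vector g x - basis_vector (g \<otimes>\<^bsub>G\<^esub> h) x + basis_vector h x))"
  unfolding bar_boundary_def using assms by (intro sum.mono_neutral_left) auto

lemma bar_B1_linear:
  assumes "c \<in> bar_B1 G" "c' \<in> bar_B1 G"
  shows "(\<lambda>x. r * c x + s * c' x) \<in> bar_B1 G"
proof -
  obtain b b' where b: "b \<in> bar_C2 G" "c = bar_boundary G b" "b' \<in> bar_C2 G" "c' = bar_boundary G b'"
    using assms by (auto simp: bar_B1_def)
  define A where "A = {p. b p \<noteq> 0} \<union> {p. b' p \<noteq> 0}"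
  define e where "e p = r * b p + s * b' p" for p
  have A: "finite A" "{p. b p \<noteq> 0} \<subseteq> A" "{p. b' p \<noteq> 0} \<subseteq> A" "{p. e p \<noteq> 0} \<subseteq> A"
    using b by (auto simp: A_def e_def bar_C2_def free_real_space_def)
  have "A \<subseteq> carrier G \<times> carrier G"
    using b by (auto simp: A_def bar_C2_def free_real_space_def)
  then have "e \<in> bar_C2 G"
    using A by (auto simp: bar_C2_def free_real_space_def intro: finite_subset)
  moreover have "bar_boundary G e = (\<lambda>x. r * c x + s * c' x)"
  proof
    fix x
    show "bar_boundary G e x = r * c x + s * c' x"
      unfolding b(2,4) bar_boundary_eq_sum[OF A(1,2)] bar_boundary_eq_sum[OF A(1,3)]
        bar_boundary_eq_sum[OF A(1,4)] sum_distrib_left sum.distrib[symmetric]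
      by (rule sum.cong) (auto simp: e_def algebra_simps)
  qed
  ultimately show ?thesis by (metis bar_B1_def image_eqI)
qed

lemma bar_B1_generator:
  assumes "g \<in> carrier G" "h \<in> carrier G"
  shows "(\<lambda>x. basis_vector g x - basis_vector (g \<otimes>\<^bsub>G\<^esub> h) x + basis_vector h x) \<in> bar_B1 G"
proof -
  have "basis_vector (g, h) \<in> bar_C2 G"
    using assms by (auto simp: bar_C2_def free_real_space_def basis_vector_def)
  moreover have "bar_boundary G (basis_vector (g, h))
      = (\<lambda>x. basis_vector g x - basis_vector (g \<otimes>\<^bsub>G\<^esub> h) x + basis_vector h x)"
  proof
    fix x
    show "bar_boundary G (basis_vector (g, h)) x
        = basis_vector g x - basis_vector (g \<otimes>\<^bsub>G\<^esub> h) x + basis_vector h x"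
      using bar_boundary_eq_sum[of "{(g, h)}" "basis_vector (g, h)" G x]
      by (auto simp: basis_vector_def)
  qed
  ultimately show ?thesis by (metis bar_B1_def image_eqI)
qed

context group
begin

lemma bar_B1_one: "basis_vector \<one> \<in> bar_B1 G"
  using bar_B1_generator[of \<one> G \<one>] by simp

lemma bar_B1_inv:
  assumes "g \<in> carrier G"
  shows "(\<lambda>x. basis_vector g x + basis_vector (inv g) x) \<in> bar_B1 G"
  using bar_B1_linear[OF bar_B1_generator[of g G "inv g"] bar_B1_one, of 1 1] assms by simp

lemma bar_B1_pow:
  assumes "g \<in> carrier G"
  shows "(\<lambda>x. real n * basis_vector g x - basis_vector (g [^] n) x) \<in> bar_B1 G"
proof (induction n)
  case 0
  then show ?case using bar_B1_linear[OF bar_B1_one bar_B1_one, of "-1" 0] by simp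
next
  case (Suc n)
  show ?case
    using bar_B1_linear[OF Suc bar_B1_generator[of "g [^] n" G g], of 1 1] assms
    by (simp add: algebra_simps)
qed

lemma bar_B1_conj:
  assumes "h \<in> carrier G" "g \<in> carrier G"
  shows "(\<lambda>x. basis_vector g x - basis_vector (h \<otimes> g \<otimes> inv h) x) \<in> bar_B1 G"
proof -
  have "(\<lambda>x. 1 * (basis_vector h x - basis_vector (h \<otimes> g) x + basis_vector g x)
      + 1 * (basis_vector (h \<otimes> g) x - basis_vector (h \<otimes> g \<otimes> inv h) x + basis_vector (inv h) x))
      \<in> bar_B1 G"
    using assms by (intro bar_B1_linear bar_B1_generator) auto
  from bar_B1_linear[OF this bar_B1_inv[OF assms(1)], of 1 "-1"]
  show ?thesis by (simp add: algebra_simps)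
qed

text \<open>
  Modulo boundaries, \<open>n\<cdot>g\<close> is \<open>g\<^sup>n\<close>, which equals its conjugate, the inverse of \<open>g\<^sup>n\<close>, which is
  \<open>-n\<cdot>g\<close>. Real coefficients allow the division by \<open>2 * n\<close>.
\<close>

lemma bar_B1_if_power_conj_inverse:
  assumes g: "g \<in> carrier G" and h: "h \<in> carrier G" and "n > 0"
    and eq: "h \<otimes> g [^] (n::nat) \<otimes> inv h = inv (g [^] n)"
  shows "basis_vector g \<in> bar_B1 G"
proof -
  let ?b = "\<lambda>g x. basis_vector g x :: real"
  have 1: "(\<lambda>x. ?b (g [^] n) x - ?b (inv (g [^] n)) x) \<in> bar_B1 G"
    using bar_B1_conj[OF h, of "g [^] n"] g eq by simp
  have "(\<lambda>x. 1 * (?b (g [^] n) x - ?b (inv (g [^] n)) x)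
      + 1 * (?b (g [^] n) x + ?b (inv (g [^] n)) x)) \<in> bar_B1 G"
    by (intro bar_B1_linear 1 bar_B1_inv) (use g in simp)
  from bar_B1_linear[OF bar_B1_pow[OF g, of n] this, of "1 / real n" "1 / (2 * real n)"]
  show ?thesis using \<open>n > 0\<close> by (simp add: field_simps)
qed

text \<open>
  The linear extension of \<open>\<phi>\<close> to 1-chains sends the boundary of \<open>(a, b)\<close> to
  \<open>\<phi> a - \<phi> (a \<otimes> b) + \<phi> b = 0\<close>.
\<close>

lemma homomorphism_vanishes_on_bar_B1:
  assumes add: "\<And>x y. x \<in> carrier G \<Longrightarrow> y \<in> carrier G \<Longrightarrow> \<phi> (x \<otimes> y) = \<phi> x + (\<phi> y :: real)"
    and "basis_vector g \<in> bar_B1 G"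
  shows "\<phi> g = 0"
proof -
  obtain c where c: "c \<in> bar_C2 G" "basis_vector g = bar_boundary G c"
    using assms(2) by (auto simp: bar_B1_def)
  define A where "A = {p. c p \<noteq> 0}"
  have A: "finite A" "A \<subseteq> carrier G \<times> carrier G"
    using c(1) by (auto simp: A_def bar_C2_def free_real_space_def)
  \<comment> \<open>a finite set that contains the supports of all chains involved\<close>
  define T where "T = insert g (fst ` A \<union> snd ` A \<union> (\<lambda>(a, b). a \<otimes> b) ` A)"
  have "finite T" using A by (simp add: T_def)
  then have eval: "(\<Sum>x\<in>T. basis_vector y x * \<phi> x) = \<phi> y" if "y \<in> T" for y
    using that by (simp add: basis_vector_def if_distrib[of "\<lambda>r. r * _"] cong: if_cong)
  have "\<phi> g = (\<Sum>x\<in>T. bar_boundary G c x * \<phi> x)"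
    using eval[of g] c(2) by (simp add: T_def)
  also have "\<dots> = (\<Sum>x\<in>T. \<Sum>(a, b)\<in>A. c (a, b) *
      (basis_vector a x * \<phi> x - basis_vector (a \<otimes> b) x * \<phi> x + basis_vector b x * \<phi> x))"
  proof (rule sum.cong)
    fix x
    show "bar_boundary G c x * \<phi> x = (\<Sum>(a, b)\<in>A. c (a, b) *
      (basis_vector a x * \<phi> x - basis_vector (a \<otimes> b) x * \<phi> x + basis_vector b x * \<phi> x))"
      unfolding bar_boundary_def A_def[symmetric] sum_distrib_right
      by (rule sum.cong) (auto simp: algebra_simps)
  qed simp
  also have "\<dots> = (\<Sum>(a, b)\<in>A. c (a, b) * (\<phi> a - \<phi> (a \<otimes> b) + \<phi> b))"
  proof (subst sum.swap, intro sum.cong refl, clarify)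
    fix a b assume "(a, b) \<in> A"
    then have "a \<in> T" "b \<in> T" "a \<otimes> b \<in> T" by (force simp: T_def)+
    then show "(\<Sum>x\<in>T. c (a, b) * (basis_vector a x * \<phi> x - basis_vector (a \<otimes> b) x * \<phi> x
        + basis_vector b x * \<phi> x)) = c (a, b) * (\<phi> a - \<phi> (a \<otimes> b) + \<phi> b)"
      using eval by (simp add: sum.distrib sum_subtractf flip: sum_distrib_left)
  qed
  also have "\<dots> = 0"
    using A add by (intro sum.neutral) auto
  finally show ?thesis .
qed

end

section \<open>Groups with a free basis\<close>

context group
begin

lemma word_value_closed [simp]:
  "S \<subseteq> carrier G \<Longrightarrow> w \<in> lists (S \<times> UNIV) \<Longrightarrow> word_value G w \<in> carrier G"
  by (induction w rule: list.induct) (auto simp: word_value_def)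

lemma word_value_Nil [simp]: "word_value G [] = \<one>"
  by (simp add: word_value_def)

lemma word_value_append:
  assumes "S \<subseteq> carrier G" "v \<in> lists (S \<times> UNIV)" "w \<in> lists (S \<times> UNIV)"
  shows "word_value G (v @ w) = word_value G v \<otimes> word_value G w"
  using assms(2)
proof (induction v rule: list.induct)
  case Nil
  then show ?case using assms by simp
next
  case (Cons l v)
  obtain x e where l: "l = (x, e)" by (cases l)
  have v: "x \<in> carrier G" "v \<in> lists (S \<times> UNIV)"
    using assms(1) Cons.prems by (auto simp: l)
  then have "word_value G w \<in> carrier G" "word_value G v \<in> carrier G"
    using word_value_closed[OF assms(1)] assms(3) by blast+
  then show ?case
    using Cons.IH[OF v(2)] v(1) by (simp add: word_value_def m_assoc l)
qed

lemma word_value_inv: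
  assumes S: "S \<subseteq> carrier G" and "w \<in> lists (S \<times> UNIV)"
  shows "word_value G (word_inv w) = inv (word_value G w)"
  using assms(2)
proof (induction w rule: list.induct)
  case (Cons l w)
  obtain x e where l: "l = (x, e)" by (cases l)
  have "x \<in> S" "w \<in> lists (S \<times> UNIV)"
    using Cons.prems by (simp_all add: l)
  then have x: "x \<in> carrier G" "x \<in> S" "w \<in> lists (S \<times> UNIV)"
    using S by blast+
  have "word_value G (word_inv (l # w)) = inv (word_value G w) \<otimes> word_value G [letter_inv l]"
    using Cons x by (simp add: word_value_append[OF S] letter_inv_def l)
  moreover have "word_value G [letter_inv l] = inv (word_value G [l])"
    using x by (simp add: word_value_def letter_inv_def l)
  moreover have "word_value G (l # w) = word_value G [l] \<otimes> word_value G w"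
    using word_value_append[OF S, of "[l]" w] x by (simp add: l)
  moreover have "word_value G [l] \<in> carrier G"
    using S x by (intro word_value_closed) (auto simp: l)
  ultimately show ?case using S x by (simp add: inv_mult_group)
qed simp

lemma word_value_power:
  assumes "S \<subseteq> carrier G" "w \<in> lists (S \<times> UNIV)"
  shows "word_value G (concat (replicate n w)) = word_value G w [^] n"
proof (induction n)
  case (Suc n)
  have "concat (replicate n w) \<in> lists (S \<times> UNIV)"
    using assms(2) by (induction n) auto
  then show ?case
    using Suc assms nat_pow_Suc2[of "word_value G w" n] by (simp add: word_value_append)
qed simp

end

locale group_with_free_basis = group K for K (structure) +
  fixes S :: "'a set"
  assumes free_basis: "free_basis K S"
begin

definition normal_form :: "'a \<Rightarrow> ('a \<times> bool) list" where
  "normal_form = inv_into {w \<in> lists (S \<times> UNIV). reduced_word w} (word_value K)"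

lemma basis_carrier: "S \<subseteq> carrier K"
  using free_basis by (simp add: free_basis_def)

lemma bij_word_value:
  "bij_betw (word_value K) {w \<in> lists (S \<times> UNIV). reduced_word w} (carrier K)"
  using free_basis by (simp add: free_basis_def)

lemma normal_form:
  assumes "x \<in> carrier K"
  shows "normal_form x \<in> lists (S \<times> UNIV)" "reduced_word (normal_form x)"
    "word_value K (normal_form x) = x"
proof -
  have "x \<in> word_value K ` {w \<in> lists (S \<times> UNIV). reduced_word w}"
    using assms bij_word_value by (simp add: bij_betw_def)
  from inv_into_into[OF this] f_inv_into_f[OF this]
  show "normal_form x \<in> lists (S \<times> UNIV)" "reduced_word (normal_form x)"
    "word_value K (normal_form x) = x"
    by (simp_all add: normal_form_def)
qed

lemma normal_form_word_value:
  assumes "w \<in> lists (S \<times> UNIV)" "reduced_word w"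
  shows "normal_form (word_value K w) = w"
  unfolding normal_form_def using assms bij_word_value
  by (intro inv_into_f_f) (auto simp: bij_betw_def)

lemma normal_form_inv:
  assumes "x \<in> carrier K"
  shows "normal_form (inv x) = word_inv (normal_form x)"
  using normal_form_word_value[of "word_inv (normal_form x)"] normal_form[OF assms]
    word_value_inv[OF basis_carrier, of "normal_form x"] by simp

lemma normal_form_mult:
  assumes "x \<in> carrier K" "y \<in> carrier K"
  obtains a b c where "normal_form x = a @ b" "normal_form y = word_inv b @ c"
    "normal_form (x \<otimes> y) = a @ c"
proof -
  note nf = normal_form[OF assms(1)] normal_form[OF assms(2)]
  obtain a b c where abc: "normal_form x = a @ b" "normal_form y = word_inv b @ c" "reduced_word (a @ c)"
    using reduced_product_decomposition[OF nf(2,5)] .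
  have lists: "a \<in> lists (S \<times> UNIV)" "b \<in> lists (S \<times> UNIV)" "c \<in> lists (S \<times> UNIV)"
    using nf(1,4) unfolding abc(1,2) by simp_all
  have "x = word_value K a \<otimes> word_value K b" "y = inv (word_value K b) \<otimes> word_value K c"
    using nf(3,6) abc(1,2) lists
    by (simp_all add: word_value_append[OF basis_carrier] word_value_inv[OF basis_carrier])
  then have "x \<otimes> y = word_value K (a @ c)"
    using lists basis_carrier by (simp add: word_value_append[OF basis_carrier] m_assoc)
  then have "normal_form (x \<otimes> y) = a @ c"
    using normal_form_word_value[of "a @ c"] lists abc(3) by simp
  then show ?thesis using that abc by blast
qed

lemma length_normal_form_mult:
  assumes "x \<in> carrier K" "y \<in> carrier K"
  shows "length (normal_form (x \<otimes> y)) \<le> length (normal_form x) + length (normal_form y)"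
  using normal_form_mult[OF assms] by (metis length_append le_add1 le_add2 add_le_mono)

lemma normal_form_power:
  assumes "r \<in> lists (S \<times> UNIV)" "reduced_word (r @ r)"
  shows "normal_form (word_value K r [^] n) = concat (replicate n r)"
proof -
  have "concat (replicate n r) \<in> lists (S \<times> UNIV)"
    using assms(1) by (induction n) auto
  then show ?thesis
    using normal_form_word_value[of "concat (replicate n r)"] reduced_power[OF assms(2)]
      word_value_power[OF basis_carrier assms(1)] by simp
qed

lemma cyclically_reduced_conjugate:
  assumes "x \<in> carrier K" "x \<noteq> \<one>"
  obtains r where "r \<in> lists (S \<times> UNIV)" "reduced_word (r @ r)" "r \<noteq> []"
    "conjugate_in K (word_value K r) x"
proof -
  note nf = normal_form[OF assms(1)]
  obtain y r where yr: "normal_form x = y @ r @ word_inv y" "reduced_word (r @ r)"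
    using cyclic_reduction[OF nf(2)] .
  have lists: "y \<in> lists (S \<times> UNIV)" "r \<in> lists (S \<times> UNIV)"
    using nf(1) yr(1) by auto
  have x: "x = word_value K y \<otimes> word_value K r \<otimes> inv (word_value K y)"
    using nf(3) yr(1) lists basis_carrier
    by (simp add: word_value_append[OF basis_carrier] word_value_inv[OF basis_carrier] m_assoc)
  have y: "word_value K y \<in> carrier K" using lists basis_carrier by simp
  have "r \<noteq> []" using x y assms(2) by auto
  moreover have "conjugate_in K (word_value K r) x"
    using x y by (auto simp: conjugate_in_def)
  ultimately show ?thesis using that lists(2) yr(2) by blast
qed

lemma signed_count_quasimorphism:
  assumes "reduced_word u" "unbordered u"
  shows "antisymmetric_quasimorphism K (\<lambda>x. signed_count u (normal_form x)) 2"
proof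
  show "defect_bound K (\<lambda>x. signed_count u (normal_form x)) 2"
    unfolding defect_bound_def
  proof (intro conjI ballI)
    fix x y assume "x \<in> carrier K" "y \<in> carrier K"
    then obtain a b c where "normal_form x = a @ b" "normal_form y = word_inv b @ c"
      "normal_form (x \<otimes> y) = a @ c"
      by (rule normal_form_mult)
    then show "\<bar>signed_count u (normal_form (x \<otimes> y)) - signed_count u (normal_form x)
        - signed_count u (normal_form y)\<bar> \<le> 2"
      using signed_count_defect[OF assms] by simp
  qed simp
qed (simp add: normal_form_inv signed_count_inv)

text \<open>
  The length of the \<open>n\<close>-th power of a cyclically reduced word is exactly \<open>n\<close> times its length, whereas
  conjugation by \<open>z\<close> adds at most \<open>2 * l\<close>, twice the length of \<open>z\<close>. The exponent \<open>n = 2 * l + 1\<close> is the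
  first at which this is contradictory for \<open>a > b\<close>.
\<close>

lemma conjugate_powers_exponent_le:
  fixes a b :: nat
  assumes x: "x \<in> carrier K" "x \<noteq> \<one>" and conj: "conjugate_in K (x [^] b) (x [^] a)"
  shows "a \<le> b"
proof (rule ccontr)
  assume "\<not> a \<le> b"
  obtain r where r: "r \<in> lists (S \<times> UNIV)" "reduced_word (r @ r)" "r \<noteq> []"
    "conjugate_in K (word_value K r) x"
    using cyclically_reduced_conjugate[OF x] .
  define c where "c = word_value K r"
  have c: "c \<in> carrier K" using r(1) basis_carrier by (simp add: c_def)
  have pow: "conjugate_in K (c [^] k) (x [^] k)" for k :: nat
    using conjugate_in_pow[OF c, of x k] r(4) by (simp add: c_def)
  have "conjugate_in K (c [^] b) (x [^] a)"
    using conjugate_in_trans[OF _ pow conj] c by simp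
  moreover have "conjugate_in K (x [^] a) (c [^] a)"
    using conjugate_in_sym[OF _ pow] c by simp
  ultimately have "conjugate_in K (c [^] b) (c [^] a)"
    using conjugate_in_trans[of "c [^] b"] c by simp
  then obtain z where z: "z \<in> carrier K" "z \<otimes> c [^] b \<otimes> inv z = c [^] a"
    by (auto simp: conjugate_in_def)
  define l where "l = length (normal_form z)"
  define n where "n = 2 * l + 1"
  have len: "length (normal_form (c [^] k)) = k * length r" for k :: nat
    using normal_form_power[OF r(1,2)] by (simp add: c_def length_concat sum_list_replicate)
  have "c [^] (a * n) = (z \<otimes> c [^] b \<otimes> inv z) [^] n"
    using z(2) c by (simp add: nat_pow_pow)
  also have "\<dots> = z \<otimes> c [^] (b * n) \<otimes> inv z"
    using conjugate_pow[of z "c [^] b" n] z(1) c by (simp add: nat_pow_pow)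
  finally have "a * n * length r = length (normal_form (z \<otimes> c [^] (b * n) \<otimes> inv z))"
    by (metis len)
  also have "\<dots> \<le> length (normal_form (z \<otimes> c [^] (b * n))) + l"
    using length_normal_form_mult[of "z \<otimes> c [^] (b * n)" "inv z"] z(1) c
    by (simp add: normal_form_inv l_def)
  also have "\<dots> \<le> l + b * n * length r + l"
    using length_normal_form_mult[of z "c [^] (b * n)"] z(1) c len by (simp add: l_def)
  finally have "a * n * length r \<le> b * n * length r + 2 * l" by simp
  moreover have "(b + 1) * n * length r \<le> a * n * length r"
    using \<open>\<not> a \<le> b\<close> by (intro mult_right_mono) auto
  ultimately have "n * length r \<le> 2 * l" by (simp add: algebra_simps)
  moreover have "n * 1 \<le> n * length r" using r(3) by (intro mult_left_mono) (cases r; auto)+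
  ultimately show False by (simp add: n_def)
qed

lemma conjugate_powers_exponent_eq:
  fixes a b :: nat
  assumes "x \<in> carrier K" "x \<noteq> \<one>" "conjugate_in K (x [^] b) (x [^] a)"
  shows "a = b"
  using conjugate_powers_exponent_le[OF assms]
    conjugate_powers_exponent_le[OF assms(1,2) conjugate_in_sym[OF _ assms(3)]] assms(1) by simp

text \<open>
  The windows of length \<open>length r * p\<close> at \<open>0\<close> and at \<open>s\<close> are powers of \<open>r\<close> and of \<open>u\<close>, respectively, and the
  window between \<open>0\<close> and \<open>s\<close> conjugates one into the other.
\<close>

lemma window_value_conjugate:
  assumes r: "r \<in> lists (S \<times> UNIV)" "r \<noteq> []" and p: "period (periodic_word r) p"
    and u: "u = window (periodic_word r) s p" "u \<in> lists (S \<times> UNIV)"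
  shows "conjugate_in K (word_value K r [^] p) (word_value K u [^] length r)"
proof -
  let ?R = "periodic_word r"
  define L where "L = length r * p"
  have w: "window ?R t n \<in> lists (S \<times> UNIV)" for t n
    using window_in_lists[OF r] .
  define x where "x = word_value K (window ?R 0 s)"
  have x: "x \<in> carrier K" using w basis_carrier by (simp add: x_def)
  have L: "window ?R 0 L = concat (replicate p r)" "window ?R s L = concat (replicate (length r) u)"
    using window_periodic_word[of r p] window_power[OF p, of s "length r"] u(1)
    by (simp_all add: L_def mult.commute)
  have "window ?R L s = window ?R 0 s"
    using window_period_shift[OF period_periodic_word[OF r(2)], of 0 p s]
    by (simp add: L_def mult.commute)
  then have "window ?R 0 s @ window ?R s L = window ?R 0 L @ window ?R 0 s"
    using window_add[of ?R 0 s L] window_add[of ?R 0 L s] by (simp add: add.commute)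
  then have "x \<otimes> word_value K u [^] length r = word_value K r [^] p \<otimes> x"
    unfolding x_def using w L
    by (metis word_value_append[OF basis_carrier] word_value_power[OF basis_carrier] u(2) r(1))
  then have "inv x \<otimes> word_value K r [^] p \<otimes> inv (inv x) = word_value K u [^] length r"
    using x basis_carrier r(1) u(2) by (simp add: m_assoc) (metis cancel_left(2) nat_pow_closed word_value_closed)
  then show ?thesis using x unfolding conjugate_in_def by blast
qed

text \<open>
  Count the word \<open>u\<close> of \<open>distinguishing_factor_exists\<close> for cyclically reduced conjugates of the \<open>v i\<close>.
  If its inverse occurred in the periodic word of \<open>v j\<close>, a power of \<open>v i\<close> would be conjugate to a
  power of \<open>u\<close> and an inverse power of \<open>v j\<close> to the same power of \<open>u\<close>. So the negative part of the count
  vanishes on all powers, and the positive part grows by at least one per power of \<open>v i\<close>.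
\<close>

lemma distinguishing_quasimorphism_exists:
  fixes v :: "'i \<Rightarrow> 'a"
  assumes "finite I" "I \<noteq> {}"
    and v: "\<And>i. i \<in> I \<Longrightarrow> v i \<in> carrier K" "\<And>i. i \<in> I \<Longrightarrow> v i \<noteq> \<one>"
    and no_inverse: "\<And>i j a b. i \<in> I \<Longrightarrow> j \<in> I \<Longrightarrow> a > 0 \<Longrightarrow> b > 0 \<Longrightarrow>
      \<not> conjugate_in K (v i [^] (a::nat)) (inv (v j [^] (b::nat)))"
  obtains \<psi> where "antisymmetric_quasimorphism K \<psi> 2"
    "\<And>i. i \<in> I \<Longrightarrow> homogenization K \<psi> (v i) \<ge> 0"
    "\<exists>i\<in>I. homogenization K \<psi> (v i) \<ge> 1"
proof -
  have "\<exists>r. r \<in> lists (S \<times> UNIV) \<and> reduced_word (r @ r) \<and> r \<noteq> [] \<and>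
      conjugate_in K (word_value K r) (v i)" if "i \<in> I" for i
    using cyclically_reduced_conjugate[OF v[OF that]] by metis
  then obtain r where r: "\<And>i. i \<in> I \<Longrightarrow> r i \<in> lists (S \<times> UNIV)"
    "\<And>i. i \<in> I \<Longrightarrow> reduced_word (r i @ r i)" "\<And>i. i \<in> I \<Longrightarrow> r i \<noteq> []"
    "\<And>i. i \<in> I \<Longrightarrow> conjugate_in K (word_value K (r i)) (v i)"
    by metis
  obtain u i s where i: "i \<in> I" and u: "unbordered u"
    "u = window (periodic_word (r i)) s (length u)" "period (periodic_word (r i)) (length u)"
    and inverse_period: "\<And>j t. j \<in> I \<Longrightarrow> word_inv u = window (periodic_word (r j)) t (length u) \<Longrightarrow>
       period (periodic_word (r j)) (length u)"
    using distinguishing_factor_exists[OF assms(1,2), of r] r(3) by metis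
  have "u \<noteq> []" using u(1) by (simp add: unbordered_def)
  have red: "reduced_word u" using reduced_window[OF r(2,3)[OF i]] u(2) by metis
  have "u \<in> lists (S \<times> UNIV)"
    using window_in_lists[OF r(1,3)[OF i]] u(2) by metis
  define c where "c j = word_value K (r j)" for j
  have c: "c j \<in> carrier K" if "j \<in> I" for j
    using r(1)[OF that] basis_carrier by (simp add: c_def)
  have no_inverse_window: "word_inv u \<noteq> window (periodic_word (r j)) t (length u)" if j: "j \<in> I" for j t
  proof
    assume eq: "word_inv u = window (periodic_word (r j)) t (length u)"
    define x where "x = word_value K u"
    define m n where "m = length (r i)" and "n = length (r j)"
    have x: "x \<in> carrier K" using \<open>u \<in> lists (S \<times> UNIV)\<close> basis_carrier by (simp add: x_def)
    have "conjugate_in K (c i [^] length u) (x [^] m)"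
      using window_value_conjugate[OF r(1,3)[OF i] u(3,2)] \<open>u \<in> lists (S \<times> UNIV)\<close>
      by (simp add: c_def x_def m_def)
    then have "conjugate_in K ((c i [^] length u) [^] n) ((x [^] m) [^] n)"
      using c[OF i] by (intro conjugate_in_pow) auto
    moreover have "conjugate_in K (v i [^] (length u * n)) ((c i [^] length u) [^] n)"
      using conjugate_in_sym[OF _ conjugate_in_pow[OF _ r(4)[OF i], of "length u * n"]] c[OF i]
      by (simp add: c_def nat_pow_pow)
    ultimately have 1: "conjugate_in K (v i [^] (length u * n)) (x [^] (m * n))"
      using conjugate_in_trans[of "v i [^] (length u * n)"] v(1)[OF i] x by (simp add: nat_pow_pow)
    have "conjugate_in K (c j [^] length u) (inv x [^] n)"
    proof -
      have "word_inv u \<in> lists (S \<times> UNIV)" using \<open>u \<in> lists (S \<times> UNIV)\<close> by simp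
      then have "conjugate_in K (c j [^] length u) (word_value K (word_inv u) [^] n)"
        unfolding c_def n_def
        by (rule window_value_conjugate[OF r(1,3)[OF j] inverse_period[OF j eq] eq])
      then show ?thesis
        using word_value_inv[OF basis_carrier \<open>u \<in> lists (S \<times> UNIV)\<close>] by (simp add: x_def)
    qed
    then have "conjugate_in K (inv x [^] n) (c j [^] length u)"
      by (rule conjugate_in_sym[OF nat_pow_closed[OF c[OF j]]])
    then have "conjugate_in K ((inv x [^] n) [^] m) ((c j [^] length u) [^] m)"
      using x by (intro conjugate_in_pow) auto
    moreover have "conjugate_in K ((c j [^] length u) [^] m) (v j [^] (length u * m))"
      using conjugate_in_pow[OF _ r(4)[OF j], of "length u * m"] c[OF j]
      by (simp add: c_def nat_pow_pow)
    ultimately have "conjugate_in K (inv x [^] (n * m)) (v j [^] (length u * m))"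
      using conjugate_in_trans[of "inv x [^] (n * m)"] x by (simp add: nat_pow_pow)
    from conjugate_in_inv[OF _ this]
    have "conjugate_in K (x [^] (m * n)) (inv (v j [^] (length u * m)))"
      using x by (simp add: nat_pow_inv mult.commute)
    then have "conjugate_in K (v i [^] (length u * n)) (inv (v j [^] (length u * m)))"
      using conjugate_in_trans[OF _ 1] v(1)[OF i] by simp
    moreover have "length u * n > 0" "length u * m > 0"
      using \<open>u \<noteq> []\<close> r(3)[OF i] r(3)[OF j] by (auto simp: m_def n_def)
    ultimately show False using no_inverse[OF i j] by blast
  qed
  define \<psi> where "\<psi> x = signed_count u (normal_form x)" for x
  interpret antisymmetric_quasimorphism K \<psi> 2
    using signed_count_quasimorphism[OF red u(1)] by (simp add: \<psi>_def[abs_def])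
  have count: "\<psi> (c j [^] n) = real (occurrences u (concat (replicate n (r j))))" if j: "j \<in> I" for j n
  proof -
    define w where "w = concat (replicate n (r j))"
    have "occurrences u (word_inv w) = 0"
    proof (rule ccontr)
      assume "occurrences u (word_inv w) \<noteq> 0"
      then obtain a b where "word_inv w = a @ u @ b" using occurrences_eq_0_or_infix[of u "word_inv w"] by auto
      then have "w = word_inv b @ word_inv u @ word_inv a"
        by (metis append_assoc word_inv_simps(3,4))
      then show False
        using infix_of_power[of n "r j" "word_inv b" "word_inv u" "word_inv a"] no_inverse_window[OF j]
        by (simp add: w_def)
    qed
    then show ?thesis
      using normal_form_power[OF r(1,2)[OF j], of n] by (simp add: \<psi>_def signed_count_def c_def w_def)
  qed
  have hom: "homogenization K \<psi> (v j) = homogenization K \<psi> (c j)" if j: "j \<in> I" for j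
    using homogeneous_quasimorphism_conj[OF homogenization_defect(1) c[OF j]] r(4)[OF j]
    by (simp add: c_def)
  have "homogenization K \<psi> (v j) \<ge> 0" if j: "j \<in> I" for j
    unfolding hom[OF j] using homogenization_tendsto[OF c[OF j]]
    by (rule LIMSEQ_le_const) (simp add: count[OF j])
  moreover have "homogenization K \<psi> (v i) \<ge> 1"
  proof -
    define C where "C = s + length u"
    have "1 - real C / real n \<le> \<psi> (c i [^] n) / real n" if "n > 0" for n
    proof -
      have "real n - real C \<le> \<psi> (c i [^] n)"
      proof (cases "C \<le> n")
        case True
        then have "n - C \<le> occurrences u (concat (replicate n (r i)))"
          using occurrences_power_le[OF u(2) \<open>u \<noteq> []\<close> r(3)[OF i], of "n - C"] by (simp add: C_def)
        then show ?thesis using True by (simp add: count[OF i])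
      qed (simp add: count[OF i])
      then have "(real n - real C) / real n \<le> \<psi> (c i [^] n) / real n"
        by (intro divide_right_mono) auto
      then show ?thesis using that by (simp add: diff_divide_distrib)
    qed
    then have "\<exists>N. \<forall>n\<ge>N. 1 - real C / real n \<le> \<psi> (c i [^] n) / real n"
      by (intro exI[of _ 1]) auto
    moreover have "(\<lambda>n. 1 - real C / real n) \<longlonglongrightarrow> 1 - 0"
      by (intro tendsto_diff tendsto_const lim_const_over_n)
    ultimately show ?thesis
      unfolding hom[OF i] using LIMSEQ_le homogenization_tendsto[OF c[OF i]] by force
  qed
  ultimately show ?thesis using that[of \<psi>] i antisymmetric_quasimorphism_axioms by blast
qed

end

section \<open>Transfer\<close>

locale finite_index_subgroup = group G + subgroup H G for G (structure) and H +
  assumes finite_cosets: "finite (rcosets H)"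
begin

abbreviation subgroup_structure where
  "subgroup_structure \<equiv> G\<lparr>carrier := H\<rparr>"

lemma group_subgroup_structure: "group subgroup_structure"
  using subgroup_is_group by (simp add: group_axioms)

lemma inv_subgroup_structure: "x \<in> H \<Longrightarrow> inv\<^bsub>subgroup_structure\<^esub> x = inv x"
  by (rule m_inv_consistent[OF subgroup_axioms])

lemma pow_subgroup_structure: "x [^]\<^bsub>subgroup_structure\<^esub> (n::nat) = x [^] n"
  using nat_pow_consistent by metis

definition rep :: "'a set \<Rightarrow> 'a" where
  "rep C = (SOME x. x \<in> C)"

text \<open>
  The cocycle with values in \<open>H\<close> that records how right multiplication by \<open>g\<close> moves the chosen coset
  representatives.
\<close>

definition transition :: "'a set \<Rightarrow> 'a \<Rightarrow> 'a" where
  "transition C g = rep C \<otimes> g \<otimes> inv (rep (C #> g))"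

text \<open>
  For a homomorphism \<open>\<psi>\<close> this is its composition with the classical transfer.
\<close>

definition transfer :: "('a \<Rightarrow> real) \<Rightarrow> 'a \<Rightarrow> real" where
  "transfer \<psi> g = (\<Sum>C\<in>rcosets H. \<psi> (transition C g))"

lemma coset_carrier: "C \<in> rcosets H \<Longrightarrow> C \<subseteq> carrier G"
  by (auto simp: RCOSETS_def dest: r_coset_subset_G[OF subset])

lemma rep:
  assumes "C \<in> rcosets H"
  shows "rep C \<in> C" "rep C \<in> carrier G" "C = H #> rep C"
proof -
  have "C \<noteq> {}" using rcosets_non_empty assms by blast
  then show 1: "rep C \<in> C" unfolding rep_def by (simp add: some_in_eq)
  then show 2: "rep C \<in> carrier G" using coset_carrier[OF assms] by blast
  obtain x where "x \<in> carrier G" "C = H #> x" using assms by (auto simp: RCOSETS_def)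
  then show "C = H #> rep C" using 1 repr_independence[OF _ _ subgroup_axioms] by metis
qed

lemma coset_mult_closed: "C \<in> rcosets H \<Longrightarrow> g \<in> carrier G \<Longrightarrow> C #> g \<in> rcosets H"
  by (auto simp: RCOSETS_def coset_mult_assoc[OF subset])

lemma coset_mult_mult:
  "C \<in> rcosets H \<Longrightarrow> g \<in> carrier G \<Longrightarrow> h \<in> carrier G \<Longrightarrow> C #> (g \<otimes> h) = C #> g #> h"
  by (simp add: coset_mult_assoc[OF coset_carrier])

lemma coset_mult_1: "C \<in> rcosets H \<Longrightarrow> C #> \<one> = C"
  by (simp add: coset_carrier)

lemma coset_mult_cancel:
  assumes "C \<in> rcosets H" "g \<in> carrier G"
  shows "C #> g #> inv g = C" "C #> inv g #> g = C"
  using assms by (simp_all add: coset_mult_1 flip: coset_mult_mult)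

lemma transition_closed:
  assumes C: "C \<in> rcosets H" and g: "g \<in> carrier G"
  shows "transition C g \<in> H"
proof -
  have "rep C \<otimes> g \<in> C #> g" using rep(1)[OF C] by (auto simp: r_coset_def)
  also have "C #> g = H #> rep (C #> g)" using rep(3) coset_mult_closed C g by blast
  finally obtain h where "h \<in> H" "rep C \<otimes> g = h \<otimes> rep (C #> g)" by (auto simp: r_coset_def)
  then show ?thesis
    using rep(2)[OF coset_mult_closed[OF C g]] by (simp add: transition_def m_assoc)
qed

lemma transition_carrier [simp]:
  "C \<in> rcosets H \<Longrightarrow> g \<in> carrier G \<Longrightarrow> transition C g \<in> carrier G"
  using transition_closed subset by blast

lemma transition_mult:
  assumes C: "C \<in> rcosets H" and g: "g \<in> carrier G" "h \<in> carrier G"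
  shows "transition C (g \<otimes> h) = transition C g \<otimes> transition (C #> g) h"
  using rep(2)[OF C] rep(2)[OF coset_mult_closed[OF C g(1)]] g
    rep(2)[OF coset_mult_closed[OF coset_mult_closed[OF C g(1)] g(2)]]
  by (simp add: transition_def m_assoc coset_mult_mult[OF C])

lemma transition_inv:
  assumes C: "C \<in> rcosets H" and g: "g \<in> carrier G"
  shows "transition (C #> g) (inv g) = inv (transition C g)"
  using rep(2)[OF C] rep(2)[OF coset_mult_closed[OF C g]] g
  by (simp add: transition_def coset_mult_cancel[OF C g] inv_mult_group m_assoc)

lemma sum_coset_mult:
  assumes "g \<in> carrier G"
  shows "(\<Sum>C\<in>rcosets H. f (C #> g)) = (\<Sum>C\<in>rcosets H. f C)"
  using assms
  by (intro sum.reindex_bij_witness[where i = "\<lambda>C. C #> inv g" and j = "\<lambda>C. C #> g"])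
    (auto simp: coset_mult_cancel intro: coset_mult_closed)

text \<open>
  By the cocycle identity and because \<open>g\<close> permutes the cosets, the defect of the transfer is a sum
  over the cosets of defects of \<open>\<psi>\<close>.
\<close>

lemma transfer_quasimorphism:
  assumes "antisymmetric_quasimorphism subgroup_structure \<psi> D"
  shows "antisymmetric_quasimorphism G (transfer \<psi>) (real (card (rcosets H)) * D)"
proof -
  interpret K: antisymmetric_quasimorphism subgroup_structure \<psi> D by fact
  show ?thesis
  proof
    show "defect_bound G (transfer \<psi>) (real (card (rcosets H)) * D)"
      unfolding defect_bound_def
    proof (intro conjI ballI)
      show "0 \<le> real (card (rcosets H)) * D" using K.defect_nonneg by simp
      fix g h assume g: "g \<in> carrier G" and h: "h \<in> carrier G"
      have "transfer \<psi> (g \<otimes> h) - transfer \<psi> g - transfer \<psi> h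
          = (\<Sum>C\<in>rcosets H. \<psi> (transition C g \<otimes> transition (C #> g) h)
              - \<psi> (transition C g) - \<psi> (transition (C #> g) h))"
        unfolding transfer_def sum_coset_mult[OF g, of "\<lambda>C. \<psi> (transition C h)", symmetric]
        using g h by (simp add: transition_mult sum_subtractf)
      also have "\<bar>\<dots>\<bar> \<le> (\<Sum>C\<in>rcosets H. \<bar>\<psi> (transition C g \<otimes> transition (C #> g) h)
              - \<psi> (transition C g) - \<psi> (transition (C #> g) h)\<bar>)"
        by (rule sum_abs)
      also have "\<dots> \<le> (\<Sum>C\<in>rcosets H. D)"
        using K.almost_additive g h
        by (intro sum_mono) (simp add: transition_closed coset_mult_closed)
      finally show "\<bar>transfer \<psi> (g \<otimes> h) - transfer \<psi> g - transfer \<psi> h\<bar>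
          \<le> real (card (rcosets H)) * D" by simp
    qed
  next
    fix g assume g: "g \<in> carrier G"
    have "\<psi> (transition (C #> g) (inv g)) = - \<psi> (transition C g)" if "C \<in> rcosets H" for C
      using K.antisymmetric[of "transition C g"] that g
      by (simp add: transition_inv transition_closed inv_subgroup_structure)
    then show "transfer \<psi> (inv g) = - transfer \<psi> g"
      unfolding transfer_def sum_coset_mult[OF g, of "\<lambda>C. \<psi> (transition C (inv g))", symmetric]
      by (simp add: sum_negf)
  qed
qed

lemma coset_pow_diff:
  fixes i j :: nat
  assumes C: "C \<in> rcosets H" and g: "g \<in> carrier G"
    and "i < j" and eq: "C #> g [^] i = C #> g [^] j"
  shows "C #> g [^] (j - i) = C"
proof -
  have "g [^] j = g [^] (j - i) \<otimes> g [^] i"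
    using \<open>i < j\<close> g by (simp add: nat_pow_mult)
  then have "C #> g [^] (j - i) #> g [^] i #> inv (g [^] i) = C #> g [^] i #> inv (g [^] i)"
    using eq C g by (simp flip: coset_mult_mult)
  then show ?thesis
    using C g by (simp add: coset_mult_cancel coset_mult_closed)
qed

text \<open>
  The powers of \<open>g\<close> take \<open>C\<close> to only finitely many cosets.
\<close>

lemma coset_power_returns:
  assumes C: "C \<in> rcosets H" and g: "g \<in> carrier G"
  obtains k :: nat where "k > 0" "C #> g [^] k = C"
proof -
  have "range (\<lambda>n::nat. C #> g [^] n) \<subseteq> rcosets H"
    using coset_mult_closed[OF C] g by auto
  then have "\<not> inj (\<lambda>n::nat. C #> g [^] n)"
    using finite_cosets finite_subset range_inj_infinite by blast
  then obtain i j :: nat where ij: "i < j" "C #> g [^] i = C #> g [^] j"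
    unfolding inj_def by (metis linorder_neqE_nat)
  then show ?thesis
    using that[of "j - i"] coset_pow_diff[OF C g] by simp
qed

lemma coset_mult_pow_fixed:
  assumes C: "C \<in> rcosets H" "g \<in> carrier G" and "C #> g = C"
  shows "C #> g [^] (n::nat) = C"
  using assms by (induction n) (simp_all add: coset_mult_1 coset_mult_mult)

text \<open>
  For such \<open>g\<close> the transition along \<open>g\<^sup>n\<close> is the \<open>n\<close>-th power of the transition along \<open>g\<close>.
\<close>

lemma homogenization_transfer:
  assumes "antisymmetric_quasimorphism subgroup_structure \<psi> D" and g: "g \<in> carrier G"
    and fixed: "\<And>C. C \<in> rcosets H \<Longrightarrow> C #> g = C"
  shows "homogenization G (transfer \<psi>) g
    = (\<Sum>C\<in>rcosets H. homogenization subgroup_structure \<psi> (transition C g))"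
proof -
  interpret K: antisymmetric_quasimorphism subgroup_structure \<psi> D by fact
  interpret T: antisymmetric_quasimorphism G "transfer \<psi>" "real (card (rcosets H)) * D"
    by (rule transfer_quasimorphism[OF assms(1)])
  have "transition C (g [^] n) = transition C g [^] n" if C: "C \<in> rcosets H" for C and n :: nat
    using conjugate_pow[OF rep(2)[OF C] g] fixed[OF C] coset_mult_pow_fixed[OF C g fixed[OF C]]
    by (simp add: transition_def)
  then have "(\<lambda>n. transfer \<psi> (g [^] n) / real n)
      = (\<lambda>n. \<Sum>C\<in>rcosets H. \<psi> (transition C g [^]\<^bsub>subgroup_structure\<^esub> n) / real n)"
    by (simp add: transfer_def pow_subgroup_structure sum_divide_distrib)
  moreover have "(\<lambda>n. \<Sum>C\<in>rcosets H. \<psi> (transition C g [^]\<^bsub>subgroup_structure\<^esub> n) / real n)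
      \<longlonglongrightarrow> (\<Sum>C\<in>rcosets H. homogenization subgroup_structure \<psi> (transition C g))"
    using K.homogenization_tendsto transition_closed[OF _ g] by (intro tendsto_sum) simp
  ultimately show ?thesis
    using LIMSEQ_unique[OF T.homogenization_tendsto[OF g]] by simp
qed

definition return_time :: "'a set \<Rightarrow> 'a \<Rightarrow> nat" where
  "return_time C g = (LEAST k. k > 0 \<and> C #> g [^] k = C)"

lemma return_time:
  assumes "C \<in> rcosets H" "g \<in> carrier G"
  shows "return_time C g > 0" "C #> g [^] return_time C g = C"
proof -
  have "\<exists>k::nat. k > 0 \<and> C #> g [^] k = C" using coset_power_returns[OF assms] by metis
  from LeastI_ex[OF this]
  show "return_time C g > 0" "C #> g [^] return_time C g = C" by (simp_all add: return_time_def)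
qed

lemma return_time_le:
  "k > 0 \<Longrightarrow> C #> g [^] k = C \<Longrightarrow> return_time C g \<le> k"
  unfolding return_time_def by (intro Least_le) simp

lemma orbit_inj:
  assumes C: "C \<in> rcosets H" and g: "g \<in> carrier G"
  shows "inj_on (\<lambda>j. C #> g [^] j) {..<return_time C g}"
proof -
  have False if ij: "i < j" "j < return_time C g" "C #> g [^] i = C #> g [^] j" for i j
    using return_time_le[of "j - i" C g] coset_pow_diff[OF C g ij(1,3)] ij(1,2) by simp
  then show ?thesis by (auto simp: inj_on_def) (metis linorder_neqE_nat)
qed

text \<open>
  Since \<open>g\<^sup>m\<close> and \<open>g\<^sup>j\<close> commute, the transition of \<open>C\<close> along \<open>g\<^sup>j\<close> conjugates one into the other.
\<close>

lemma transition_orbit_conjugate: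
  assumes C: "C \<in> rcosets H" and g: "g \<in> carrier G" and "C #> g [^] (m::nat) = C"
  shows "conjugate_in subgroup_structure (transition C (g [^] m))
    (transition (C #> g [^] (j::nat)) (g [^] m))"
proof -
  define t where "t = transition C (g [^] j)"
  have t: "t \<in> H" using C g by (simp add: t_def transition_closed)
  have gg: "g [^] m \<in> carrier G" "g [^] j \<in> carrier G" using g by simp_all
  have D: "C #> g [^] j \<in> rcosets H" using C g by (simp add: coset_mult_closed)
  have "t \<otimes> transition (C #> g [^] j) (g [^] m) = transition C (g [^] m) \<otimes> t"
    unfolding t_def using C g assms(3) transition_mult[OF C gg(2,1)] transition_mult[OF C gg(1,2)]
    by (simp add: nat_pow_comm)
  then have "inv t \<otimes> transition C (g [^] m) \<otimes> inv (inv t) = transition (C #> g [^] j) (g [^] m)"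
    using t subset C D gg by (simp add: m_assoc subset_iff)
      (metis cancel_left(2) mem_carrier transition_carrier)
  then show ?thesis
    unfolding conjugate_in_def using t inv_subgroup_structure by (intro bexI[of _ "inv t"]) simp_all
qed

end

text \<open>
  The relation turns \<open>i\<close>-th powers into inverse \<open>j\<close>-th powers. Applying it twice removes the inversion,
  and iterating this puts any power of \<open>t \<otimes> t\<close> in the place of \<open>t\<close>.
\<close>

lemma (in group) conj_power_swap:
  assumes g: "g \<in> carrier G" and t: "t \<in> carrier G"
    and eq: "t \<otimes> g [^] (i::nat) \<otimes> inv t = inv (g [^] (j::nat))"
  shows "(t \<otimes> t) [^] n \<otimes> g [^] ((i * i) ^ n) \<otimes> inv ((t \<otimes> t) [^] (n::nat)) = g [^] ((j * j) ^ n)"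
proof (induction n)
  case (Suc n)
  have step: "t \<otimes> g [^] (i * k) \<otimes> inv t = inv (g [^] (j * k))" for k
    using conjugate_pow[OF t, of "g [^] i" k] eq g by (simp add: nat_pow_pow nat_pow_inv)
  define s where "s = t \<otimes> t"
  have s: "s \<in> carrier G" using t by (simp add: s_def)
  have square: "s \<otimes> g [^] (i * i * k) \<otimes> inv s = g [^] (j * j * k)" for k
  proof -
    have "s \<otimes> g [^] (i * i * k) \<otimes> inv s = t \<otimes> (t \<otimes> g [^] (i * (i * k)) \<otimes> inv t) \<otimes> inv t"
      using g t by (simp add: s_def m_assoc inv_mult_group mult.assoc)
    also have "\<dots> = t \<otimes> inv (g [^] (i * (j * k))) \<otimes> inv t"
      unfolding step by (simp add: mult.left_commute)
    also have "\<dots> = inv (t \<otimes> g [^] (i * (j * k)) \<otimes> inv t)"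
      using g t by (simp add: m_assoc inv_mult_group)
    also have "\<dots> = g [^] (j * j * k)"
      unfolding step using g by (simp add: mult.assoc)
    finally show ?thesis .
  qed
  have "s [^] Suc n \<otimes> g [^] ((i * i) ^ Suc n) \<otimes> inv (s [^] Suc n)
      = s [^] n \<otimes> (s \<otimes> g [^] (i * i * (i * i) ^ n) \<otimes> inv s) \<otimes> inv (s [^] n)"
    using g s by (simp add: m_assoc inv_mult_group)
  also have "\<dots> = s [^] n \<otimes> (g [^] ((i * i) ^ n)) [^] (j * j) \<otimes> inv (s [^] n)"
    unfolding square using g by (simp add: nat_pow_pow mult.commute)
  also have "\<dots> = (s [^] n \<otimes> g [^] ((i * i) ^ n) \<otimes> inv (s [^] n)) [^] (j * j)"
    using g s by (simp add: conjugate_pow)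
  also have "\<dots> = g [^] ((j * j) ^ Suc n)"
    using Suc g by (simp add: s_def nat_pow_pow mult.commute)
  finally show ?case by (simp add: s_def)
qed (use g in simp)

section \<open>The quasimorphism and the spectral gap\<close>

locale virtually_free_group = finite_index_subgroup G H + K: group_with_free_basis "G\<lparr>carrier := H\<rparr>" S
  for G (structure) and H S
begin

text \<open>
  Some power of \<open>t \<otimes> t\<close> and some power \<open>x\<close> of \<open>g\<close> lie in \<open>H\<close>. By \<open>conj_power_swap\<close>, two positive
  powers of \<open>x\<close> are conjugate within the free group \<open>H\<close>, where this forces equal exponents.
\<close>

lemma conj_inverse_exponents_eq:
  assumes g: "g \<in> carrier G" and infinite_order: "\<And>n. n > 0 \<Longrightarrow> g [^] (n::nat) \<noteq> \<one>"
    and t: "t \<in> carrier G" and "i > 0" "j > 0"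
    and eq: "t \<otimes> g [^] (i::nat) \<otimes> inv t = inv (g [^] (j::nat))"
  shows "i = j"
proof -
  have H: "H \<in> rcosets H" using subgroup_in_rcosets[OF is_group] by simp
  have in_H: "x \<in> H" if "x \<in> carrier G" "H #> x = H" for x
    using that rcos_self[OF that(1) subgroup_axioms] by simp
  define s where "s = t \<otimes> t"
  have s: "s \<in> carrier G" using t by (simp add: s_def)
  obtain N :: nat where N: "N > 0" "H #> s [^] N = H" using coset_power_returns[OF H s] .
  obtain m :: nat where m: "m > 0" "H #> g [^] m = H" using coset_power_returns[OF H g] .
  define x where "x = g [^] m"
  have x: "x \<in> H" "x \<noteq> \<one>" using m g in_H infinite_order by (simp_all add: x_def)
  have sN: "s [^] N \<in> H" using N(2) s in_H by simp
  have "s [^] N \<otimes> x [^] ((i * i) ^ N) \<otimes> inv (s [^] N)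
      = (s [^] N \<otimes> g [^] ((i * i) ^ N) \<otimes> inv (s [^] N)) [^] m"
    using s g by (simp add: x_def conjugate_pow nat_pow_pow mult.commute)
  also have "\<dots> = x [^] ((j * j) ^ N)"
    using conj_power_swap[OF g t eq, of N] g by (simp add: s_def x_def nat_pow_pow mult.commute)
  finally have "conjugate_in subgroup_structure (x [^] ((i * i) ^ N)) (x [^] ((j * j) ^ N))"
    using sN by (auto simp: conjugate_in_def inv_subgroup_structure)
  then have "(j * j) ^ N = (i * i) ^ N"
    using x by (intro K.conjugate_powers_exponent_eq) (simp_all add: pow_subgroup_structure)
  then have "j * j = i * i" using N(1) power_eq_iff_eq_base[of N "j * j" "i * i"] by simp
  then show "i = j" by (metis power2_eq_square power_eq_iff_eq_base zero_le zero_less_numeral)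
qed

text \<open>
  The cosets in the orbit of \<open>C0\<close> under \<open>g\<close> have transitions along \<open>g\<^sup>m\<close> that are conjugate in \<open>H\<close> to the
  power of \<open>v C0\<close> with exponent \<open>m\<close> divided by the size of the orbit. Together they contribute \<open>m\<close> times
  the value at \<open>v C0\<close>, hence at least \<open>m\<close>, and all other cosets contribute nonnegative values.
\<close>

theorem detecting_quasimorphism_exists:
  assumes g: "g \<in> carrier G"
    and no_inverse: "\<And>n. n > 0 \<Longrightarrow> \<not> conjugate_in G (g [^] (n::nat)) (inv (g [^] n))"
  obtains \<phi> where "homogeneous_quasimorphism G \<phi>" "\<phi> g \<ge> 1"
    "defect_bound G \<phi> (4 * real (card (rcosets H)))"
proof -
  let ?k = "\<lambda>C. return_time C g"
  define v where "v C = transition C (g [^] ?k C)" for C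
  have v_eq: "v C = rep C \<otimes> g [^] ?k C \<otimes> inv (rep C)" if "C \<in> rcosets H" for C
    using return_time(2)[OF that g] by (simp add: v_def transition_def)
  have v_H: "v C \<in> H" if "C \<in> rcosets H" for C
    using transition_closed[OF that] g by (simp add: v_def)
  have infinite_order: "g [^] n \<noteq> \<one>" if "n > 0" for n :: nat
  proof
    assume "g [^] n = \<one>"
    then have "conjugate_in G (g [^] n) (inv (g [^] n))"
      by (auto simp: conjugate_in_def intro: bexI[of _ \<one>])
    then show False using no_inverse that by blast
  qed
  have v_one: "v C \<noteq> \<one>" if C: "C \<in> rcosets H" for C
  proof
    assume "v C = \<one>"
    then have "g [^] ?k C = inv (rep C) \<otimes> \<one> \<otimes> rep C"
      using rep(2)[OF C] g by (simp add: v_eq[OF C] m_assoc flip: \<open>v C = \<one>\<close>)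
    then show False using infinite_order return_time(1)[OF C g] rep(2)[OF C] by simp
  qed
  have v_pow: "v C [^] (a::nat) = rep C \<otimes> g [^] (?k C * a) \<otimes> inv (rep C)" if C: "C \<in> rcosets H" for C a
    using conjugate_pow[OF rep(2)[OF C]] g by (simp add: v_eq[OF C] nat_pow_pow)
  have no_inverse_v: "\<not> conjugate_in subgroup_structure (v C [^]\<^bsub>subgroup_structure\<^esub> a)
      (inv\<^bsub>subgroup_structure\<^esub> (v C' [^]\<^bsub>subgroup_structure\<^esub> b))"
    if C: "C \<in> rcosets H" and C': "C' \<in> rcosets H" and "a > 0" "b > 0" for C C' and a b :: nat
  proof
    assume "conjugate_in subgroup_structure (v C [^]\<^bsub>subgroup_structure\<^esub> a)
      (inv\<^bsub>subgroup_structure\<^esub> (v C' [^]\<^bsub>subgroup_structure\<^esub> b))"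
    moreover have "v C' [^] b \<in> H"
      using K.nat_pow_closed[of "v C'" b] v_H[OF C'] by (simp add: pow_subgroup_structure)
    ultimately obtain h where h: "h \<in> H" "h \<otimes> v C [^] a \<otimes> inv h = inv (v C' [^] b)"
      by (auto simp: conjugate_in_def pow_subgroup_structure inv_subgroup_structure)
    define i j where "i = ?k C * a" and "j = ?k C' * b"
    have ij: "i > 0" "j > 0"
      using return_time(1) C C' g that(3,4) by (simp_all add: i_def j_def)
    define t where "t = inv (rep C') \<otimes> h \<otimes> rep C"
    have carrier: "rep C \<in> carrier G" "rep C' \<in> carrier G" "h \<in> carrier G"
      using rep(2) C C' h(1) by auto
    have t: "t \<in> carrier G" using carrier by (simp add: t_def)
    have "t \<otimes> g [^] i \<otimes> inv t = inv (rep C') \<otimes> (h \<otimes> v C [^] a \<otimes> inv h) \<otimes> rep C'"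
      using carrier g by (simp add: t_def v_pow[OF C] i_def m_assoc inv_mult_group)
    also have "\<dots> = inv (g [^] j)"
      unfolding h(2) using carrier g by (simp add: v_pow[OF C'] j_def m_assoc inv_mult_group)
    finally have eq: "t \<otimes> g [^] i \<otimes> inv t = inv (g [^] j)" .
    then have "i = j" using conj_inverse_exponents_eq[OF g infinite_order t ij] by simp
    then show False using no_inverse[OF ij(1)] eq t by (auto simp: conjugate_in_def)
  qed
  have "H \<in> rcosets H" using subgroup_in_rcosets[OF is_group] by simp
  then have "rcosets H \<noteq> {}" by blast
  obtain \<psi> where \<psi>: "antisymmetric_quasimorphism subgroup_structure \<psi> 2"
    and nonneg: "\<And>C. C \<in> rcosets H \<Longrightarrow> homogenization subgroup_structure \<psi> (v C) \<ge> 0"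
    and "\<exists>C\<in>rcosets H. homogenization subgroup_structure \<psi> (v C) \<ge> 1"
  proof (rule K.distinguishing_quasimorphism_exists[OF finite_cosets \<open>rcosets H \<noteq> {}\<close>, of v])
  qed (use v_H v_one no_inverse_v in auto)
  then obtain C0 where C0: "C0 \<in> rcosets H" "homogenization subgroup_structure \<psi> (v C0) \<ge> 1" by blast
  interpret \<psi>: antisymmetric_quasimorphism subgroup_structure \<psi> 2 by fact
  interpret T: antisymmetric_quasimorphism G "transfer \<psi>" "real (card (rcosets H)) * 2"
    by (rule transfer_quasimorphism[OF \<psi>])
  \<comment> \<open>a common multiple of the return times, so that \<open>g\<^sup>m\<close> fixes every coset\<close>
  define m where "m = (\<Prod>C\<in>rcosets H. ?k C)"
  have m: "m > 0" using return_time(1)[OF _ g] by (simp add: m_def prod_pos)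
  have dvd: "?k C dvd m" if "C \<in> rcosets H" for C
    unfolding m_def using that finite_cosets by (rule dvd_prodI[rotated])
  have fixed: "C #> g [^] m = C" if C: "C \<in> rcosets H" for C
  proof -
    obtain q where "m = ?k C * q" using dvd[OF C] by blast
    then show ?thesis
      using coset_mult_pow_fixed[OF C, of "g [^] ?k C" q] return_time(2)[OF C g] g
      by (simp add: nat_pow_pow)
  qed
  define w where "w C = transition C (g [^] m)" for C
  define f where "f = homogenization subgroup_structure \<psi>"
  have f_w: "f (w C) * real (?k C) = real m * f (v C)" if C: "C \<in> rcosets H" for C
  proof -
    obtain q where q: "m = ?k C * q" using dvd[OF C] by blast
    have "w C = v C [^] q"
      using fixed[OF C] v_pow[OF C, of q] by (simp add: w_def transition_def q[symmetric])
    then have "f (w C) = real q * f (v C)"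
      using \<psi>.homogenization_nat_pow[of "v C" q] v_H[OF C] by (simp add: f_def pow_subgroup_structure)
    then show ?thesis using arg_cong[OF q, of real] by simp
  qed
  have f_nonneg: "f (w C) \<ge> 0" if C: "C \<in> rcosets H" for C
  proof -
    have "0 \<le> f (w C) * real (?k C)" using f_w[OF C] nonneg[OF C] by (simp add: f_def)
    then show ?thesis using return_time(1)[OF C g] by (simp add: zero_le_mult_iff)
  qed
  have f_orbit: "f (w (C0 #> g [^] j)) = f (w C0)" for j :: nat
    unfolding w_def f_def
    by (intro group.homogeneous_quasimorphism_conj[OF group_subgroup_structure \<psi>.homogenization_defect(1)]
        transition_orbit_conjugate C0(1) g fixed)
      (use C0(1) g in \<open>simp add: transition_closed\<close>)
  have "real m \<le> real (?k C0) * f (w C0)"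
    using f_w[OF C0(1)] C0(2) m by (simp add: f_def mult.commute)
  also have "\<dots> = (\<Sum>j<?k C0. f (w (C0 #> g [^] j)))"
    by (simp add: f_orbit)
  also have "\<dots> = (\<Sum>C\<in>(\<lambda>j. C0 #> g [^] j) ` {..<?k C0}. f (w C))"
    using sum.reindex[OF orbit_inj[OF C0(1) g], of "\<lambda>C. f (w C)"] by simp
  also have "\<dots> \<le> (\<Sum>C\<in>rcosets H. f (w C))"
    using finite_cosets f_nonneg coset_mult_closed[OF C0(1)] g by (intro sum_mono2) auto
  also have "\<dots> = homogenization G (transfer \<psi>) (g [^] m)"
    using homogenization_transfer[OF \<psi>, of "g [^] m"] fixed g by (simp add: f_def w_def)
  also have "\<dots> = real m * homogenization G (transfer \<psi>) g"
    by (rule T.homogenization_nat_pow[OF g])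
  finally have "homogenization G (transfer \<psi>) g \<ge> 1" using m by simp
  then show ?thesis
    using that[of "homogenization G (transfer \<psi>)"] T.homogenization_defect by (simp add: mult.commute)
qed

end

lemma defect_le: "defect_bound G \<phi> D \<Longrightarrow> defect G \<phi> \<le> D"
  unfolding defect_def by (rule cInf_lower) (auto simp: defect_bound_def intro!: bdd_belowI[of _ 0])

lemma defect_bound_defect:
  assumes "quasimorphism G \<phi>"
  shows "defect_bound G \<phi> (defect G \<phi>)"
proof -
  have ne: "{D. defect_bound G \<phi> D} \<noteq> {}" using assms by (auto simp: quasimorphism_def)
  have "c \<le> defect G \<phi>" if "\<And>D. defect_bound G \<phi> D \<Longrightarrow> c \<le> D" for c
    unfolding defect_def using ne that by (intro cInf_greatest) auto
  then show ?thesis unfolding defect_bound_def by blast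
qed

lemma (in group) conj_inverse_power_iff:
  assumes g: "g \<in> carrier G"
  shows "(\<exists>n::int. n \<noteq> 0 \<and> conjugate_in G (g [^] n) (g [^] (- n))) \<longleftrightarrow>
    (\<exists>n::nat. n > 0 \<and> conjugate_in G (g [^] n) (inv (g [^] n)))"
proof
  assume "\<exists>n::nat. n > 0 \<and> conjugate_in G (g [^] n) (inv (g [^] n))"
  then obtain n :: nat where n: "n > 0" "conjugate_in G (g [^] n) (inv (g [^] n))" by blast
  then show "\<exists>n::int. n \<noteq> 0 \<and> conjugate_in G (g [^] n) (g [^] (- n))"
    using g by (intro exI[of _ "int n"]) (simp add: int_pow_int int_pow_neg)
next
  assume "\<exists>n::int. n \<noteq> 0 \<and> conjugate_in G (g [^] n) (g [^] (- n))"
  then obtain n :: int where n: "n \<noteq> 0" "conjugate_in G (g [^] n) (g [^] (- n))" by blast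
  show "\<exists>n::nat. n > 0 \<and> conjugate_in G (g [^] n) (inv (g [^] n))"
  proof (cases n rule: int_cases2)
    case (nonneg k)
    then show ?thesis using n g by (intro exI[of _ k]) (simp add: int_pow_int int_pow_neg)
  next
    case (nonpos k)
    then show ?thesis
      using n g conjugate_in_sym[of "inv (g [^] k)" "g [^] k"]
      by (intro exI[of _ k]) (simp add: int_pow_int int_pow_neg)
  qed
qed

lemma (in group) scl_eq_0_if_conj_inverse_power:
  assumes g: "g \<in> carrier G" and n: "n > 0" "conjugate_in G (g [^] (n::nat)) (inv (g [^] n))"
  shows "scl G g = 0"
proof -
  have B1: "basis_vector g \<in> bar_B1 G"
    using n(2) bar_B1_if_power_conj_inverse[OF g _ n(1)] by (auto simp: conjugate_in_def)
  have zero: "\<phi> g = 0" if \<phi>: "homogeneous_quasimorphism G \<phi>" for \<phi>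
  proof -
    have "\<phi> (g [^] k) = of_int k * \<phi> g" for k :: int
      using \<phi> g by (simp add: homogeneous_quasimorphism_def)
    from this[of "int n"] this[of "- int n"]
    have "\<phi> (g [^] n) = real n * \<phi> g" "\<phi> (inv (g [^] n)) = - real n * \<phi> g"
      using g by (simp_all add: int_pow_int int_pow_neg)
    moreover have "\<phi> (inv (g [^] n)) = \<phi> (g [^] n)"
      using homogeneous_quasimorphism_conj[OF \<phi> _ n(2)] g by simp
    ultimately show ?thesis using n(1) by simp
  qed
  show ?thesis
  proof (cases "scl_ratios G g = {}")
    case False
    moreover have "scl_ratios G g \<subseteq> {0}" by (auto simp: scl_ratios_def zero)
    ultimately have "scl_ratios G g = {0}" by blast
    then show ?thesis using B1 by (simp add: scl_def)
  qed (simp add: scl_def B1)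
qed

text \<open>
  If \<open>g\<close> is a boundary, the defect of \<open>\<phi>\<close> is positive, as a homomorphism would vanish at \<open>g\<close>.
\<close>

lemma (in group) scl_ge:
  assumes "homogeneous_quasimorphism G \<phi>" "\<phi> g \<ge> 1" "defect_bound G \<phi> D"
  shows "scl G g \<ge> ereal (1 / (2 * D))"
proof (cases "basis_vector g \<in> bar_B1 G")
  case True
  have bound: "defect_bound G \<phi> (defect G \<phi>)"
    using assms(1) by (intro defect_bound_defect) (simp add: homogeneous_quasimorphism_def)
  have "defect G \<phi> \<noteq> 0"
  proof
    assume "defect G \<phi> = 0"
    then have "\<bar>\<phi> (x \<otimes> y) - \<phi> x - \<phi> y\<bar> \<le> 0" if "x \<in> carrier G" "y \<in> carrier G" for x y
      using bound that by (simp add: defect_bound_def)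
    then have "\<phi> (x \<otimes> y) = \<phi> x + \<phi> y" if "x \<in> carrier G" "y \<in> carrier G" for x y
      using that by (simp add: algebra_simps)
    then show False using homomorphism_vanishes_on_bar_B1[of \<phi> g] True assms(2) by simp
  qed
  moreover have "defect G \<phi> \<ge> 0" using bound by (simp add: defect_bound_def)
  ultimately have pos: "defect G \<phi> > 0" by simp
  then have ratio: "ereal (\<phi> g / (2 * defect G \<phi>)) \<in> scl_ratios G g"
    unfolding scl_ratios_def using assms(1) by blast
  have "1 / (2 * D) \<le> \<phi> g / (2 * defect G \<phi>)"
    using pos defect_le[OF assms(3)] assms(2) by (intro frac_le) auto
  also have "ereal \<dots> \<le> Sup (scl_ratios G g)" by (rule Sup_upper[OF ratio])
  finally show ?thesis using True ratio by (auto simp: scl_def)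
qed (simp add: scl_def)

theorem corollary1p2:
  fixes G :: "('a, 'b) monoid_scheme" and H :: "'a set" and d :: nat and g :: 'a
  assumes "group G"
    and "subgroup H G" and "free_group (G\<lparr>carrier := H\<rparr>)"
    and "finite (rcosets\<^bsub>G\<^esub> H)" and "card (rcosets\<^bsub>G\<^esub> H) = d"
    and "g \<in> carrier G"
  shows "(scl G g = 0 \<longleftrightarrow>
            (\<exists>n::int. n \<noteq> 0 \<and> conjugate_in G (g [^]\<^bsub>G\<^esub> n) (g [^]\<^bsub>G\<^esub> (- n)))) \<and>
         (scl G g \<noteq> 0 \<longrightarrow> scl G g \<ge> ereal (1 / (8 * real d)))"
proof -
  interpret group G by fact
  obtain S where "free_basis (G\<lparr>carrier := H\<rparr>) S"
    using assms(3) by (auto simp: free_group_def)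
  then interpret virtually_free_group G H S
    using assms(1-4) by (simp add: virtually_free_group_def finite_index_subgroup_def
        finite_index_subgroup_axioms_def group_with_free_basis_def
        group_with_free_basis_axioms_def free_group_def)
  show ?thesis
  proof (cases "\<exists>n::nat. n > 0 \<and> conjugate_in G (g [^]\<^bsub>G\<^esub> n) (inv\<^bsub>G\<^esub> (g [^]\<^bsub>G\<^esub> n))")
    case True
    then show ?thesis
      using scl_eq_0_if_conj_inverse_power[OF assms(6)] conj_inverse_power_iff[OF assms(6)] by auto
  next
    case False
    then obtain \<phi> where \<phi>: "homogeneous_quasimorphism G \<phi>" "\<phi> g \<ge> 1" "defect_bound G \<phi> (4 * real d)"
      using detecting_quasimorphism_exists[OF assms(6)] assms(5) by metis
    have ge: "scl G g \<ge> ereal (1 / (8 * real d))"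
      using scl_ge[OF \<phi>] by simp
    have "H \<in> rcosets\<^bsub>G\<^esub> H" using subgroup_in_rcosets[OF is_group] by simp
    then have "d > 0" using assms(4,5) card_gt_0_iff by blast
    then have "ereal (1 / (8 * real d)) > 0" by simp
    then have "scl G g \<noteq> 0" using ge by auto
    then show ?thesis using False ge conj_inverse_power_iff[OF assms(6)] by blast
  qed
qed

end
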